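(* Fix $A>2$, and let $\nu$ be a Borel probability measure supported on $[0,1]^2$ satisfying $\widehat{\nu}(\boldsymbol{\xi}) \ll (\log\|\boldsymbol{\xi}\|_\infty)^{-A}$ as $\|\boldsymbol{\xi}\|_\infty\to\infty$, $\boldsymbol{\xi}\in\mathbb{Z}^2$. Let $\alpha\in\mathcal{K}$ and $\gamma\in\mathbb{R}$. For $\beta,\delta\in\mathbb{R}$ and $N\in\mathbb{N}$, write $\widetilde{\mathcal{N}}(\alpha,\beta,\gamma,\delta,N)$ for the number of integers $n$ with $2\le n\le N$ such that $$\|n\alpha-\gamma\|\cdot\|n\beta-\delta\|\le\frac{1}{n\log n}.$$ Let $\mathcal{R}(\alpha,\gamma)$ be the set of $(\beta,\delta)\in\mathbb{R}^2$ such that $\widetilde{\mathcal{N}}(\alpha,\beta,\gamma,\delta,N)\gg\log\log N$ holds for all sufficiently large $N$. Then $\nu(\mathcal{R}(\alpha,\gamma))=1$.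
   Context: For $x\in\mathbb{R}$, $\|x\|$ denotes the distance from $x$ to the nearest integer. For $\alpha\in\mathbb{R}\setminus\mathbb{Q}$, $q_1(\alpha),q_2(\alpha),\ldots$ is the sequence of continued fraction denominators (denominators of the convergents) of $\alpha$, and $\mathcal{K}$ is the set of irrational real $\alpha$ with $\sup_{k\ge1}k^{-1}\log q_k(\alpha)<\infty$. The Fourier transform is $\widehat{\nu}(\boldsymbol{\xi}) = \int e(-\boldsymbol{\xi}\cdot\mathbf{x})\,d\nu(\mathbf{x})$ with $e(x)=e^{2\pi i x}$; $\|\boldsymbol{\xi}\|_\infty=\max(|\xi_1|,|\xi_2|)$. The notation $f\ll g$ means $|f|\le C|g|$ for some constant $C>0$; $f(N)\gg g(N)$ means $f(N)\ge c\,g(N)$ for some constant $c>0$ independent of $N$ (it may depend on $\beta,\delta$). *)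

theory Defs
  imports "HOL-Probability.Probability"
begin

definition dist_int :: "real \<Rightarrow> real" where
  "dist_int x = \<bar>x - of_int (round x)\<bar>"

text \<open>Complete quotients and partial quotients of the regular continued fraction. For rational
  arguments the expansion terminates, and the values past that point are meaningless (they come
  from division by zero); only irrational arguments are used.\<close>

primrec complete_quotient :: "real \<Rightarrow> nat \<Rightarrow> real" where
  "complete_quotient \<alpha> 0 = \<alpha>"
| "complete_quotient \<alpha> (Suc k) = 1 / frac (complete_quotient \<alpha> k)"

definition partial_quotient :: "real \<Rightarrow> nat \<Rightarrow> int" where
  "partial_quotient \<alpha> k = \<lfloor>complete_quotient \<alpha> k\<rfloor>"

text \<open>Denominators of the convergents \<open>[a\<^sub>0; a\<^sub>1, \<dots>, a\<^sub>k]\<close>, indexed such that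
  \<open>q\<^sub>0 = 1\<close> and \<open>q\<^sub>1 = a\<^sub>1\<close>.\<close>

fun cf_denom :: "real \<Rightarrow> nat \<Rightarrow> int" where
  "cf_denom \<alpha> 0 = 1"
| "cf_denom \<alpha> (Suc 0) = partial_quotient \<alpha> 1"
| "cf_denom \<alpha> (Suc (Suc k)) =
     partial_quotient \<alpha> (Suc (Suc k)) * cf_denom \<alpha> (Suc k) + cf_denom \<alpha> k"

definition class_K :: "real set" where
  "class_K = {\<alpha>. \<alpha> \<notin> \<rat> \<and>
     bdd_above ((\<lambda>k. ln (real_of_int (cf_denom \<alpha> k)) / real k) ` {1..})}"

definition unit_exp :: "real \<Rightarrow> complex" where
  "unit_exp x = exp (2 * of_real pi * \<i> * of_real x)"

definition fourier_transform :: "(real \<times> real) measure \<Rightarrow> real \<times> real \<Rightarrow> complex" where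
  "fourier_transform \<nu> \<xi> = (\<integral>x. unit_exp (- (\<xi> \<bullet> x)) \<partial>\<nu>)"

definition counting :: "real \<Rightarrow> real \<Rightarrow> real \<Rightarrow> real \<Rightarrow> nat \<Rightarrow> nat" where
  "counting \<alpha> \<beta> \<gamma> \<delta> N =
     card {n::nat. 2 \<le> n \<and> n \<le> N \<and>
       dist_int (real n * \<alpha> - \<gamma>) * dist_int (real n * \<beta> - \<delta>) \<le> 1 / (real n * ln (real n))}"

text \<open>The implied constant \<open>c\<close> may depend on \<open>\<beta>\<close> and \<open>\<delta>\<close>, but not on \<open>N\<close>.\<close>

definition good_set :: "real \<Rightarrow> real \<Rightarrow> (real \<times> real) set" where
  "good_set \<alpha> \<gamma> = {(\<beta>, \<delta>). \<exists>c>0. \<forall>\<^sub>F N in sequentially.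
     real (counting \<alpha> \<beta> \<gamma> \<delta> N) \<ge> c * ln (ln (real N))}"

end

theory Submission
  imports Defs
begin

text \<open>
  It is enough to look at a sparse sequence of integers \<open>n\<^sub>k\<close> for which
  \<open>\<parallel>n\<^sub>k \<alpha> - \<gamma>\<parallel>\<close> is as small as inhomogeneous approximation permits, namely at most \<open>5 / n\<^sub>k\<close>.
  Such integers are found next to the denominators of convergents of \<open>\<alpha>\<close>; they can be taken lacunary, and
  since \<open>\<alpha>\<close> lies in the class K they grow no faster than exponentially
  (\<open>class_K_lacunary_sequence\<close>).  For \<open>n = n\<^sub>k\<close> the inequality to be counted follows from
  \<open>\<parallel>n\<^sub>k \<beta> - \<delta>\<parallel> \<le> 1 / (B (k + 1) + 1)\<close> with a suitable constant \<open>B\<close>.  If the points \<open>n\<^sub>k \<beta> - \<delta>\<close> were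
  independent and uniform modulo 1, of the order of \<open>ln K\<close> of the first \<open>K\<close> of these events would occur,
  and \<open>K\<close> may be taken proportional to \<open>ln N\<close>; this is the source of the iterated logarithm.

  To make this rigorous for \<open>\<nu>\<close>, each event is bounded from below by a trigonometric
  polynomial in \<open>n\<^sub>k \<beta> - \<delta>\<close> of degree proportional to \<open>k\<close> with mean proportional to \<open>1 / k\<close>
  (\<open>trigonometric_minorant\<close>).  The correlation of the nonconstant parts with indices \<open>l \<le> k\<close> is a finite
  combination of Fourier coefficients of \<open>\<nu>\<close> at the points \<open>(m' n\<^sub>l - m n\<^sub>k, m - m')\<close>.
  Lacunarity makes the first coordinate exponentially large in \<open>k\<close>, except for few pairs
  \<open>(m, m')\<close> (\<open>card_resonant_pairs\<close>).  The Fourier decay therefore bounds each correlation by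
  \<open>k\<^bsup>-A\<^esup>\<close> up to a resonant term of the order \<open>2\<^bsup>l-k\<^esup> / k\<close>.  Because \<open>A > 2\<close>, the sum over all
  \<open>l \<le> k < K\<close> is \<open>O(ln K)\<close> (\<open>second_moment_oscillation\<close>), which is small compared with the square of the
  total mean.  Chebyshev's inequality and the Borel-Cantelli lemma along \<open>K = 2 ^ 2 ^ j\<close> then give the lower
  bound almost surely (\<open>AE_hits_lower_bound\<close>).
\<close>

section \<open>Convergents and inhomogeneous approximation\<close>

fun cf_num :: "real \<Rightarrow> nat \<Rightarrow> int" where
  "cf_num \<alpha> 0 = partial_quotient \<alpha> 0"
| "cf_num \<alpha> (Suc 0) = partial_quotient \<alpha> 1 * partial_quotient \<alpha> 0 + 1"
| "cf_num \<alpha> (Suc (Suc k)) =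
     partial_quotient \<alpha> (Suc (Suc k)) * cf_num \<alpha> (Suc k) + cf_num \<alpha> k"

lemma complete_quotient_irrational:
  assumes "\<alpha> \<notin> \<rat>"
  shows "complete_quotient \<alpha> k \<notin> \<rat>"
proof (induction k)
  case (Suc k)
  have "frac (complete_quotient \<alpha> k) \<notin> \<rat>"
    using Suc.IH Rats_add[of "frac (complete_quotient \<alpha> k)" "of_int \<lfloor>complete_quotient \<alpha> k\<rfloor>"]
    by (auto simp: frac_def)
  then show ?case
    using Rats_inverse[of "1 / frac (complete_quotient \<alpha> k)"] by auto
qed (use assms in simp)

lemma frac_complete_quotient_pos:
  assumes "\<alpha> \<notin> \<rat>"
  shows "frac (complete_quotient \<alpha> k) > 0"
  using complete_quotient_irrational[OF assms, of k] frac_ge_0[of "complete_quotient \<alpha> k"]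
  by (metis Ints_subset_Rats frac_eq_0_iff less_eq_real_def subsetD)

lemma complete_quotient_Suc_gt_1:
  assumes "\<alpha> \<notin> \<rat>"
  shows "complete_quotient \<alpha> (Suc k) > 1"
  using frac_complete_quotient_pos[OF assms, of k] frac_lt_1[of "complete_quotient \<alpha> k"]
  by simp

lemma partial_quotient_Suc_ge_1:
  assumes "\<alpha> \<notin> \<rat>"
  shows "partial_quotient \<alpha> (Suc k) \<ge> 1"
  using complete_quotient_Suc_gt_1[OF assms, of k] unfolding partial_quotient_def
  by linarith

lemma complete_quotient_step:
  assumes "\<alpha> \<notin> \<rat>"
  shows "complete_quotient \<alpha> k
    = of_int (partial_quotient \<alpha> k) + 1 / complete_quotient \<alpha> (Suc k)"
  by (simp add: partial_quotient_def frac_def)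

lemma cf_denom_pos:
  assumes "\<alpha> \<notin> \<rat>"
  shows "cf_denom \<alpha> k \<ge> 1"
  using partial_quotient_Suc_ge_1[OF assms]
proof (induction \<alpha> k rule: cf_denom.induct)
  case (3 \<alpha> k)
  have "partial_quotient \<alpha> (Suc (Suc k)) * cf_denom \<alpha> (Suc k) \<ge> 1 * 1"
    using 3 order_trans[OF zero_le_one "3.prems"[of "Suc k"]] by (intro mult_mono) auto
  then show ?case using 3 by simp
qed auto

lemma cf_denom_mono_Suc:
  assumes "\<alpha> \<notin> \<rat>"
  shows "cf_denom \<alpha> k \<le> cf_denom \<alpha> (Suc k)"
proof (cases k)
  case 0
  then show ?thesis using partial_quotient_Suc_ge_1[OF assms, of 0] by simp
next
  case (Suc j)
  have "1 * cf_denom \<alpha> (Suc j) \<le> partial_quotient \<alpha> (Suc (Suc j)) * cf_denom \<alpha> (Suc j)"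
    using partial_quotient_Suc_ge_1[OF assms, of "Suc j"] cf_denom_pos[OF assms, of "Suc j"]
    by (intro mult_right_mono) auto
  then show ?thesis using Suc cf_denom_pos[OF assms, of j] by simp
qed

lemma cf_denom_double:
  assumes "\<alpha> \<notin> \<rat>"
  shows "2 * cf_denom \<alpha> k \<le> cf_denom \<alpha> (Suc (Suc k))"
proof -
  have "1 * cf_denom \<alpha> (Suc k) \<le> partial_quotient \<alpha> (Suc (Suc k)) * cf_denom \<alpha> (Suc k)"
    using partial_quotient_Suc_ge_1[OF assms, of "Suc k"] cf_denom_pos[OF assms, of "Suc k"]
    by (intro mult_right_mono) auto
  then show ?thesis using cf_denom_mono_Suc[OF assms, of k] by simp
qed

lemma cf_determinant:
  "cf_num \<alpha> (Suc k) * cf_denom \<alpha> k - cf_num \<alpha> k * cf_denom \<alpha> (Suc k) = (-1) ^ k"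
proof (induction k)
  case (Suc k)
  then show ?case by (simp add: algebra_simps)
qed simp

text \<open>Replacing the last partial quotient of a convergent by the complete quotient recovers
  \<open>\<alpha>\<close> itself.  The step \<open>x\<^sub>k = a\<^sub>k + 1 / x\<^bsub>k+1\<^esub>\<close>, cleared of its denominator, is what carries the
  identity along.\<close>
lemma cf_complete_quotient_identity:
  assumes "\<alpha> \<notin> \<rat>"
  shows "\<alpha> * (complete_quotient \<alpha> (Suc (Suc k)) * cf_denom \<alpha> (Suc k) + cf_denom \<alpha> k)
    = complete_quotient \<alpha> (Suc (Suc k)) * cf_num \<alpha> (Suc k) + cf_num \<alpha> k"
proof (induction k)
  case 0
  define x y where "x = complete_quotient \<alpha> 1" and "y = complete_quotient \<alpha> 2"
  have pos: "x > 1" "y > 1"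
    using complete_quotient_Suc_gt_1[OF assms, of 0] complete_quotient_Suc_gt_1[OF assms, of 1]
    by (simp_all add: x_def y_def numeral_2_eq_2 del: complete_quotient.simps)
  have 1: "\<alpha> = of_int (partial_quotient \<alpha> 0) + 1 / x"
    using complete_quotient_step[OF assms, of 0] by (simp add: x_def)
  have 2: "x = of_int (partial_quotient \<alpha> 1) + 1 / y"
    using complete_quotient_step[OF assms, of 1] by (simp add: x_def y_def numeral_2_eq_2)
  have a1: "of_int (partial_quotient \<alpha> 1) = x - 1 / y" using 2 by simp
  have "\<alpha> * (y * (x - 1 / y) + 1) = y * ((x - 1 / y) * of_int (partial_quotient \<alpha> 0) + 1)
      + of_int (partial_quotient \<alpha> 0)"
    using pos by (subst 1) (simp add: field_simps)
  then show ?case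
    using a1 by (simp add: y_def numeral_2_eq_2 del: complete_quotient.simps)
next
  case (Suc k)
  define x y a where "x = complete_quotient \<alpha> (Suc (Suc k))"
    and "y = complete_quotient \<alpha> (Suc (Suc (Suc k)))"
    and "a = partial_quotient \<alpha> (Suc (Suc k))"
  have y: "y > 1" using complete_quotient_Suc_gt_1[OF assms] by (simp only: y_def)
  have x: "x = a + 1 / y"
    unfolding x_def y_def a_def by (rule complete_quotient_step[OF assms])
  have yx: "y * x = y * a + 1" using x y by (simp add: field_simps)
  have "\<alpha> * (y * (a * cf_denom \<alpha> (Suc k) + cf_denom \<alpha> k) + cf_denom \<alpha> (Suc k))
      = \<alpha> * ((y * a + 1) * cf_denom \<alpha> (Suc k) + y * cf_denom \<alpha> k)"
    by (simp add: algebra_simps)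
  also have "\<dots> = y * (\<alpha> * (x * cf_denom \<alpha> (Suc k) + cf_denom \<alpha> k))"
    unfolding yx[symmetric] by (simp add: algebra_simps)
  also have "\<dots> = y * (x * cf_num \<alpha> (Suc k) + cf_num \<alpha> k)"
    using Suc.IH unfolding x_def by simp
  also have "\<dots> = (y * x) * cf_num \<alpha> (Suc k) + y * cf_num \<alpha> k" by (simp add: algebra_simps)
  also have "\<dots> = y * (a * cf_num \<alpha> (Suc k) + cf_num \<alpha> k) + cf_num \<alpha> (Suc k)"
    unfolding yx by (simp add: algebra_simps)
  finally show ?case by (simp add: y_def a_def del: complete_quotient.simps)
qed

text \<open>Multiplying the error \<open>\<alpha> q' - p'\<close> by \<open>x q' + q\<close>, with \<open>x\<close> the next complete quotient, leaves
  only the determinant of two consecutive convergents, which is \<open>\<plusminus>1\<close>; and \<open>x > 1\<close>.\<close>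
lemma cf_approximation:
  fixes \<alpha> :: real
  assumes "\<alpha> \<notin> \<rat>"
  shows "\<bar>\<alpha> * cf_denom \<alpha> (Suc k) - cf_num \<alpha> (Suc k)\<bar> \<le> 1 / cf_denom \<alpha> (Suc k)"
proof -
  define x p q p' q' where "x = complete_quotient \<alpha> (Suc (Suc k))"
    and "p = real_of_int (cf_num \<alpha> k)" and "q = real_of_int (cf_denom \<alpha> k)"
    and "p' = real_of_int (cf_num \<alpha> (Suc k))" and "q' = real_of_int (cf_denom \<alpha> (Suc k))"
  have x: "x > 1" using complete_quotient_Suc_gt_1[OF assms] by (simp only: x_def)
  have q: "q \<ge> 1" "q' \<ge> 1" using cf_denom_pos[OF assms] by (simp_all add: q_def q'_def)
  have id: "\<alpha> * (x * q' + q) = x * p' + p"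
    using cf_complete_quotient_identity[OF assms, of k] by (simp only: x_def p_def q_def p'_def q'_def)
  have "real_of_int (cf_num \<alpha> (Suc k) * cf_denom \<alpha> k - cf_num \<alpha> k * cf_denom \<alpha> (Suc k)) = (-1) ^ k"
    unfolding cf_determinant by simp
  then have det: "p' * q - p * q' = (-1) ^ k" by (simp add: p_def q_def p'_def q'_def)
  have "1 * q' \<le> x * q'" using x q by (intro mult_right_mono) auto
  then have s: "x * q' + q \<ge> q'" using q by linarith
  have "(\<alpha> * q' - p') * (x * q' + q) = \<alpha> * (x * q' + q) * q' - p' * (x * q' + q)"
    by (simp add: algebra_simps)
  also have "\<dots> = - (p' * q - p * q')" unfolding id by (simp add: algebra_simps)
  finally have "\<bar>(\<alpha> * q' - p') * (x * q' + q)\<bar> = 1"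
    unfolding det by (simp add: power_abs)
  then have "\<bar>\<alpha> * q' - p'\<bar> * (x * q' + q) = 1"
    using s q by (simp add: abs_mult)
  then have "\<bar>\<alpha> * q' - p'\<bar> * q' \<le> 1"
    using mult_left_mono[OF s, of "\<bar>\<alpha> * q' - p'\<bar>"] by simp
  then show ?thesis using q by (simp add: p'_def q'_def field_simps)
qed

lemma dist_int_le: "dist_int x \<le> \<bar>x - of_int m\<bar>"
  unfolding dist_int_def using round_diff_minimal[of x m] by simp

text \<open>Since \<open>p\<close> is invertible modulo \<open>q\<close>, the numbers \<open>n p / q\<close> run through all fractions with denominator
  \<open>q\<close> modulo 1 as \<open>n\<close> runs through \<open>q\<close> consecutive integers, so \<open>n\<close> can be chosen to bring
  \<open>n p / q\<close> within \<open>1 / (2 q)\<close> of \<open>\<gamma>\<close> modulo 1.  Exchanging \<open>p / q\<close> for \<open>\<alpha>\<close> costs at most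
  \<open>n / q\<^sup>2 \<le> 2 / q\<close>.  The window \<open>[q, 2q)\<close> keeps \<open>n\<close> comparable to \<open>q\<close>, so that a lower bound
  for \<open>q\<close> is inherited by \<open>n\<close>.\<close>
lemma inhomogeneous_approximation:
  fixes p q :: int and \<alpha> \<gamma> :: real
  assumes "q \<ge> 1" "coprime p q" and close: "\<bar>\<alpha> * q - p\<bar> \<le> 1 / q"
  shows "\<exists>n::nat. q \<le> int n \<and> int n < 2 * q \<and> real n * dist_int (real n * \<alpha> - \<gamma>) \<le> 5"
proof -
  define t where "t = round (q * \<gamma>)"
  obtain u v where uv: "u * p + v * q = 1"
    using bezout_int[of p q] assms(2) by (auto simp: coprime_iff_gcd_eq_1)
  define r where "r = (u * t) mod q"
  have r: "0 \<le> r" "r < q" using assms(1) by (simp_all add: r_def)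
  define n where "n = q + r"
  obtain m where m: "p * n - t = q * m"
  proof
    define w where "w = u * t div q"
    have r_eq: "r = u * t - q * w" unfolding r_def w_def by (simp add: minus_mult_div_eq_mod)
    have "p * n - t = p * q + (u * p - 1) * t - q * (p * w)"
      unfolding n_def r_eq by (simp add: algebra_simps)
    also have "u * p - 1 = - v * q" using uv by simp
    finally show "p * n - t = q * (p - v * t - p * (u * t div q))"
      unfolding w_def[symmetric] by (simp add: algebra_simps)
  qed
  have n: "q \<le> n" "n < 2 * q" using r by (simp_all add: n_def)
  define Q N where "Q = real_of_int q" and "N = real_of_int n"
  have Q: "Q \<ge> 1" "N \<ge> Q" "N \<le> 2 * Q" using assms(1) n by (simp_all add: Q_def N_def)
  have m': "of_int p * N - of_int t = Q * of_int m"
    using arg_cong[OF m, of real_of_int] by (simp add: Q_def N_def)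
  have t: "\<bar>of_int t - Q * \<gamma>\<bar> \<le> 1 / 2"
    unfolding t_def Q_def by (rule of_int_round_abs_le)
  have "Q * (N * \<alpha> - \<gamma> - of_int m) = N * (\<alpha> * Q - of_int p) + (of_int t - Q * \<gamma>)"
    using m' by (simp add: algebra_simps)
  then have "\<bar>Q * (N * \<alpha> - \<gamma> - of_int m)\<bar> \<le> \<bar>N * (\<alpha> * Q - of_int p)\<bar> + 1 / 2"
    using t abs_triangle_ineq[of "N * (\<alpha> * Q - of_int p)" "of_int t - Q * \<gamma>"] by linarith
  then have "Q * \<bar>N * \<alpha> - \<gamma> - of_int m\<bar> \<le> N * \<bar>\<alpha> * Q - of_int p\<bar> + 1 / 2"
    using Q by (simp add: abs_mult)
  also have "N * \<bar>\<alpha> * Q - of_int p\<bar> \<le> (2 * Q) * (1 / Q)"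
    using close Q unfolding Q_def[symmetric] by (intro mult_mono) auto
  finally have "Q * \<bar>N * \<alpha> - \<gamma> - of_int m\<bar> \<le> 5 / 2" using Q by simp
  moreover have "N * dist_int (N * \<alpha> - \<gamma>) \<le> (2 * Q) * \<bar>N * \<alpha> - \<gamma> - of_int m\<bar>"
    using Q dist_int_le[of "N * \<alpha> - \<gamma>" m] by (intro mult_mono) (auto simp: dist_int_def)
  ultimately have "N * dist_int (N * \<alpha> - \<gamma>) \<le> 5" by simp
  then show ?thesis
    using n assms(1) by (intro exI[of _ "nat n"]) (simp add: N_def)
qed

text \<open>Denominators of convergents at least double in two steps, hence grow by a factor 8 in six.
  Choosing \<open>n\<^sub>k\<close> between the denominator of index \<open>6 (k + 1)\<close> and its double loses at most a factor 2,
  which leaves a lacunary sequence with ratio 4.  The growth condition in the class K becomes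
  \<open>ln n\<^sub>k = O(k)\<close>.\<close>
lemma class_K_lacunary_sequence:
  assumes "\<alpha> \<in> class_K"
  obtains n :: "nat \<Rightarrow> nat" and C where
    "C > 0" "\<And>k. 4 * n k \<le> n (Suc k)" "\<And>k. 4 ^ Suc k \<le> n k"
    "\<And>k. ln (real (n k)) \<le> C * real (Suc k)"
    "\<And>k. real (n k) * dist_int (real (n k) * \<alpha> - \<gamma>) \<le> 5"
proof -
  have irr: "\<alpha> \<notin> \<rat>" using assms by (simp add: class_K_def)
  define q where "q k = cf_denom \<alpha> (6 * Suc k)" for k
  obtain L where L: "\<And>k. k \<ge> 1 \<Longrightarrow> ln (real_of_int (cf_denom \<alpha> k)) / real k \<le> L"
    using assms by (auto simp: class_K_def bdd_above_def)
  have q8: "8 * q k \<le> q (Suc k)" for k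
    using cf_denom_double[OF irr, of "6 * Suc k"] cf_denom_double[OF irr, of "6 * Suc k + 2"]
      cf_denom_double[OF irr, of "6 * Suc k + 4"]
    by (simp add: q_def eval_nat_numeral del: cf_denom.simps)
  have q0: "8 \<le> q 0"
    using cf_denom_double[OF irr, of 0] cf_denom_double[OF irr, of "2"]
      cf_denom_double[OF irr, of "4"]
    by (simp add: q_def eval_nat_numeral del: cf_denom.simps(2-))
  have qpow: "8 ^ Suc k \<le> q k" for k
  proof (induction k)
    case (Suc k)
    then show ?case using q8[of k] by simp
  qed (use q0 in simp)
  have ex: "\<exists>n::nat. q k \<le> int n \<and> int n < 2 * q k \<and> real n * dist_int (real n * \<alpha> - \<gamma>) \<le> 5" for k
  proof -
    have k: "6 * Suc k = Suc (6 * k + 5)" by simp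
    have "coprime (cf_num \<alpha> (6 * Suc k)) (q k)"
    proof (rule coprimeI)
      \<comment> \<open>A common divisor divides the determinant.\<close>
      fix c assume c: "c dvd cf_num \<alpha> (6 * Suc k)" "c dvd q k"
      have "c dvd (-1) ^ (6 * k + 5)"
        unfolding cf_determinant[of \<alpha> "6 * k + 5", symmetric]
        using c unfolding q_def k by (simp del: cf_num.simps cf_denom.simps)
      then show "is_unit c" using dvd_trans by (fastforce simp: minus_one_power_iff)
    qed
    then show ?thesis
      using inhomogeneous_approximation[of "q k" "cf_num \<alpha> (6 * Suc k)" \<alpha> \<gamma>]
        cf_approximation[OF irr, of "6 * k + 5"] cf_denom_pos[OF irr, of "6 * Suc k"]
      unfolding q_def k by blast
  qed
  then obtain n where n: "\<And>k. q k \<le> int (n k)" "\<And>k. int (n k) < 2 * q k"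
    "\<And>k. real (n k) * dist_int (real (n k) * \<alpha> - \<gamma>) \<le> 5" by metis
  define C where "C = 1 + 6 * \<bar>L\<bar>"
  show thesis
  proof
    show "C > 0" by (simp add: C_def add_pos_nonneg)
    show "4 * n k \<le> n (Suc k)" for k using n(1)[of "Suc k"] n(2)[of k] q8[of k] by linarith
    show "4 ^ Suc k \<le> n k" for k
    proof -
      have "(4::int) ^ Suc k \<le> 8 ^ Suc k" by (intro power_mono) auto
      then have "int (4 ^ Suc k) \<le> int (n k)" using qpow[of k] n(1)[of k] by simp
      then show ?thesis by linarith
    qed
    show "ln (real (n k)) \<le> C * real (Suc k)" for k
    proof -
      have pos: "q k \<ge> 1" using cf_denom_pos[OF irr] by (simp add: q_def)
      have "real (n k) \<le> 2 * real_of_int (q k)" using n(2)[of k] by linarith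
      then have "ln (real (n k)) \<le> ln (2 * real_of_int (q k))"
        using n(1)[of k] pos by (subst ln_le_cancel_iff) auto
      also have "\<dots> = ln 2 + ln (real_of_int (q k))" using pos by (simp add: ln_mult)
      also have "ln (real_of_int (q k)) \<le> L * real (6 * Suc k)"
        using L[of "6 * Suc k"] by (simp add: q_def field_simps del: cf_denom.simps)
      also have "\<dots> \<le> \<bar>L\<bar> * real (6 * Suc k)" by (intro mult_right_mono) auto
      also have "ln 2 + \<bar>L\<bar> * real (6 * Suc k) \<le> real (Suc k) + \<bar>L\<bar> * real (6 * Suc k)"
        using ln_2_less_1 by simp
      also have "\<dots> = C * real (Suc k)" by (simp add: C_def algebra_simps)
      finally show ?thesis by simp
    qed
    show "real (n k) * dist_int (real (n k) * \<alpha> - \<gamma>) \<le> 5" for k by (rule n(3))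
  qed
qed


section \<open>A trigonometric minorant of a short interval\<close>

lemma norm_unit_exp [simp]: "norm (unit_exp x) = 1"
  by (simp add: unit_exp_def)

lemma unit_exp_0 [simp]: "unit_exp 0 = 1"
  by (simp add: unit_exp_def)

lemma unit_exp_add: "unit_exp (x + y) = unit_exp x * unit_exp y"
  by (simp add: unit_exp_def exp_add[symmetric] algebra_simps)

lemma cnj_unit_exp: "cnj (unit_exp x) = unit_exp (- x)"
  by (simp add: unit_exp_def exp_cnj)

lemma unit_exp_of_nat_mult: "unit_exp (real n * x) = unit_exp x ^ n"
  by (simp add: unit_exp_def exp_of_nat_mult[symmetric] algebra_simps)

lemma unit_exp_eq_cis: "unit_exp x = cis (2 * pi * x)"
  by (simp add: unit_exp_def cis_conv_exp algebra_simps)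

lemma measurable_unit_exp [measurable]: "unit_exp \<in> borel_measurable borel"
  unfolding unit_exp_def by measurable

text \<open>The eigenvector, for the largest eigenvalue \<open>2 cos (\<pi> / (M + 1))\<close>, of the adjacency matrix of a path
  with \<open>M\<close> vertices.  It is the vector of coefficients for which a polynomial \<open>D\<close> of degree
  less than \<open>M\<close> concentrates \<open>|D|\<^sup>2\<close> as much as possible near \<open>1\<close> on the unit circle, measured by the mean
  of \<open>cos (2 \<pi> x) |D|\<^sup>2\<close>.\<close>
definition sine_weight :: "nat \<Rightarrow> nat \<Rightarrow> real" where
  "sine_weight M j = sin (real j * (pi / real (Suc M)))"

lemma sine_weight_rec:
  "sine_weight M (Suc (Suc j)) + sine_weight M j
    = 2 * cos (pi / real (Suc M)) * sine_weight M (Suc j)"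
proof -
  define \<theta> where "\<theta> = pi / real (Suc M)"
  have "real (Suc (Suc j)) * \<theta> = real (Suc j) * \<theta> + \<theta>"
    "real j * \<theta> = real (Suc j) * \<theta> - \<theta>" by (simp_all add: algebra_simps)
  then show ?thesis
    unfolding sine_weight_def \<theta>_def[symmetric] by (simp add: sin_add sin_diff del: of_nat_Suc)
qed

lemma sine_weight_0 [simp]: "sine_weight M 0 = 0"
  by (simp add: sine_weight_def)

lemma sine_weight_end [simp]: "sine_weight M (Suc M) = 0"
  by (simp add: sine_weight_def del: of_nat_Suc)

lemma sine_weight_last: "sine_weight M M = sine_weight M 1"
proof -
  define \<theta> where "\<theta> = pi / real (Suc M)"
  have "real M * \<theta> = pi - \<theta>" by (simp add: \<theta>_def field_simps)
  then have "sin (real M * \<theta>) = sin \<theta>" by simp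
  then show ?thesis unfolding sine_weight_def \<theta>_def[symmetric] by simp
qed

lemma abs_sine_weight_le_1: "\<bar>sine_weight M j\<bar> \<le> 1"
  by (simp add: sine_weight_def)

lemma abs_sine_weight_1_le: "\<bar>sine_weight M 1\<bar> \<le> pi / real (Suc M)"
  using abs_sin_x_le_abs_x[of "pi / real (Suc M)"] by (simp add: sine_weight_def)

text \<open>Double angles turn the sum into one of \<open>cos (2 j \<theta>)\<close>, which vanishes: multiplied by
  \<open>2 sin \<theta>\<close> it telescopes around the full circle.\<close>
lemma sum_sine_weight_squares:
  assumes "M \<ge> 1"
  shows "(\<Sum>j<M. (sine_weight M (Suc j))\<^sup>2) = real (Suc M) / 2"
proof -
  define \<theta> where "\<theta> = pi / real (Suc M)"
  have tele: "(\<Sum>j\<le>k. 2 * sin \<theta> * cos (2 * real j * \<theta>)) = sin ((2 * real k + 1) * \<theta>) + sin \<theta>" for k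
  proof (induction k)
    case (Suc k)
    have e: "(2 * real (Suc k) + 1) * \<theta> = 2 * real (Suc k) * \<theta> + \<theta>"
      "(2 * real k + 1) * \<theta> = 2 * real (Suc k) * \<theta> - \<theta>" by (simp_all add: algebra_simps)
    show ?case unfolding sum.atMost_Suc Suc.IH e by (simp add: sin_add sin_diff)
  qed simp
  have "0 < \<theta>" "\<theta> < pi" using assms by (simp_all add: \<theta>_def field_simps)
  then have s: "sin \<theta> > 0" by (rule sin_gt_zero)
  have "(2 * real M + 1) * \<theta> = 2 * pi - \<theta>" by (simp add: \<theta>_def field_simps)
  then have "2 * sin \<theta> * (\<Sum>j\<le>M. cos (2 * real j * \<theta>)) = 0"
    using tele[of M] by (simp add: sum_distrib_left)
  then have c0: "(\<Sum>j\<le>M. cos (2 * real j * \<theta>)) = 0" using s by simp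
  have sq: "(sine_weight M j)\<^sup>2 = (1 - cos (2 * real j * \<theta>)) / 2" for j
    using cos_double_sin[of "real j * \<theta>"] by (simp add: sine_weight_def \<theta>_def mult.assoc del: of_nat_Suc)
  have "(\<Sum>j<M. (sine_weight M (Suc j))\<^sup>2) = (\<Sum>j<Suc M. (sine_weight M j)\<^sup>2)"
    unfolding sum.lessThan_Suc_shift by simp
  also have "\<dots> = (\<Sum>j\<le>M. (1 - cos (2 * real j * \<theta>)) / 2)"
    unfolding sq lessThan_Suc_atMost ..
  also have "\<dots> = (real (Suc M) - (\<Sum>j\<le>M. cos (2 * real j * \<theta>))) / 2"
    by (simp add: sum_subtractf flip: sum_divide_distrib)
  finally show ?thesis using c0 by simp
qed

text \<open>Multiplication by \<open>z + 1 / z\<close> shifts coefficients in both directions, so on an eigenvector of the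
  path it acts as the scalar \<open>2 cos (\<pi> / (M + 1))\<close> apart from what falls off the two ends.
  The identity is stated after multiplication by \<open>z\<close>, and for every truncation \<open>k\<close>, so that it follows by
  induction.\<close>
lemma sine_polynomial_identity:
  fixes z :: complex and M :: nat
  defines "D \<equiv> \<lambda>k. \<Sum>j<k. of_real (sine_weight M (Suc j)) * z ^ j"
  shows "(z\<^sup>2 + 1) * D k = of_real (2 * cos (pi / real (Suc M))) * z * D k + of_real (sine_weight M 1)
     - of_real (sine_weight M (Suc k)) * z ^ k + of_real (sine_weight M k) * z ^ Suc k"
proof (induction k)
  case (Suc k)
  have rec: "of_real (2 * cos (pi / real (Suc M))) * complex_of_real (sine_weight M (Suc k))
     = of_real (sine_weight M (Suc (Suc k))) + of_real (sine_weight M k)"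
    by (metis of_real_add of_real_mult sine_weight_rec)
  have D: "D (Suc k) = D k + of_real (sine_weight M (Suc k)) * z ^ k" by (simp add: D_def)
  have "of_real (2 * cos (pi / real (Suc M))) * z * D (Suc k)
      = of_real (2 * cos (pi / real (Suc M))) * z * D k
        + (of_real (2 * cos (pi / real (Suc M))) * of_real (sine_weight M (Suc k))) * z ^ Suc k"
    unfolding D by (simp add: algebra_simps)
  then show ?case
    unfolding rec using Suc.IH unfolding D by (simp add: algebra_simps power2_eq_square)
qed (simp add: D_def)

text \<open>With \<open>\<theta> = \<pi> / (M + 1)\<close> put \<open>G(x) = (cos (2 \<pi> x) - cos (2 \<theta>)) |D(e(x))|\<^sup>2\<close>.  The first factor is
  negative exactly outside the arc of radius \<open>1 / (M + 1)\<close>, and on the arc it is \<open>O(1 / M\<^sup>2)\<close> while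
  \<open>|D|\<^sup>2 \<le> M\<^sup>2\<close>; so \<open>G\<close> is a minorant of 20 times the indicator of the arc.  The path identity rewrites
  \<open>G\<close> as \<open>(cos \<theta> - cos (2 \<theta>)) |D|\<^sup>2\<close> plus boundary terms, all of nonzero frequency.
  Hence the mean of \<open>G\<close> is a positive quantity of the order \<open>1 / M\<close> of the length of the arc, no
  coefficient exceeds that order, and the degree is only \<open>M\<close>: there is no tail of high
  frequencies to estimate.\<close>
lemma trigonometric_minorant:
  assumes "M \<ge> (1::nat)"
  obtains a :: "int \<Rightarrow> real" and G :: "real \<Rightarrow> real" where
    "\<And>x. of_real (G x) = (\<Sum>m\<in>{- int M..int M}. of_real (a m) * unit_exp (of_int m * x))"
    "\<And>x. G x \<le> 20" "\<And>x. dist_int x > 1 / real (Suc M) \<Longrightarrow> G x \<le> 0"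
    "a 0 \<ge> 1 / real (Suc M)" "\<And>m. \<bar>a m\<bar> \<le> 30 / real (Suc M)"
proof -
  define \<theta> where "\<theta> = pi / real (Suc M)"
  define s where "s j = sine_weight M (Suc j)" for j
  define \<kappa> where "\<kappa> = cos \<theta> - cos (2 * \<theta>)"
  define D where "D x = (\<Sum>j<M. of_real (s j) * unit_exp x ^ j)" for x
  define G where "G x = (cos (2 * pi * x) - cos (2 * \<theta>)) * (norm (D x))\<^sup>2" for x
  define a where "a m = \<kappa> * (\<Sum>i<M. \<Sum>j<M. if int i - int j = m then s i * s j else 0)
      + s 0 / 2 * (\<Sum>i<M. (if - 1 - int i = m then s i else 0)
                       + (if int M - int i = m then s i else 0))" for m
  have \<theta>: "0 < \<theta>" "\<theta> \<le> pi / 2" using assms by (simp_all add: \<theta>_def field_simps)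
  have s1: "\<bar>s j\<bar> \<le> 1" for j by (simp add: s_def abs_sine_weight_le_1)
  have s0: "\<bar>s 0\<bar> \<le> \<theta>" using abs_sine_weight_1_le[of M] by (simp add: s_def \<theta>_def)
  have cos_ge: "cos \<theta> \<ge> 0" using \<theta> by (intro cos_ge_zero) auto
  have kfac: "\<kappa> = (1 - cos \<theta>) * (1 + 2 * cos \<theta>)"
    unfolding \<kappa>_def cos_double_cos by (simp add: algebra_simps power2_eq_square)
  have one_minus: "1 - cos (2 * \<theta>) \<le> 2 * \<theta>\<^sup>2"
    using abs_sin_x_le_abs_x[of \<theta>] power_mono[of "\<bar>sin \<theta>\<bar>" "\<bar>\<theta>\<bar>" 2]
    by (simp add: cos_double_sin)
  have k_up: "\<kappa> \<le> 2 * \<theta>\<^sup>2" using one_minus cos_le_one[of \<theta>] unfolding \<kappa>_def by linarith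
  \<comment> \<open>The mean value theorem and \<open>cos \<xi> \<ge> cos (\<pi> / 4) \<ge> 7 / 10 \<ge> 2 / \<pi>\<close> give the bound
    \<open>sin (\<theta> / 2) \<ge> \<theta> / \<pi>\<close>, because \<open>\<theta> / 2 \<le> \<pi> / 4\<close>.\<close>
  have k_low: "\<kappa> \<ge> 2 / (real (Suc M))\<^sup>2"
  proof -
    obtain \<xi> where \<xi>: "0 < \<xi>" "\<xi> < \<theta> / 2" "sin (\<theta> / 2) - sin 0 = (\<theta> / 2 - 0) * cos \<xi>"
      using MVT2[of 0 "\<theta> / 2" sin cos] \<theta> DERIV_sin by auto
    have "7 / 10 \<le> sqrt 2 / 2" by (rule order_trans[OF _ divide_right_mono[OF real_le_rsqrt[of "7/5" 2]]])
      (simp_all add: power2_eq_square)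
    also have "\<dots> = cos (pi / 4)" by (simp add: cos_45)
    also have "\<dots> \<le> cos \<xi>" using \<xi> \<theta> by (intro cos_monotone_0_pi_le) auto
    finally have "\<theta> / 2 * (7 / 10) \<le> \<theta> / 2 * cos \<xi>" using \<theta> by (intro mult_left_mono) auto
    then have "\<theta> / 2 * (7 / 10) \<le> sin (\<theta> / 2)" using \<xi>(3) by simp
    moreover have "\<theta> / pi \<le> \<theta> / 2 * (7 / 10)" using \<theta> pi_approx by (simp add: field_simps)
    ultimately have "sin (\<theta> / 2) \<ge> \<theta> / pi" by linarith
    then have "(\<theta> / pi)\<^sup>2 \<le> (sin (\<theta> / 2))\<^sup>2" using \<theta> by (intro power_mono) auto
    then have "2 * (\<theta> / pi)\<^sup>2 \<le> 1 - cos \<theta>" using cos_double_sin[of "\<theta> / 2"] by simp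
    also have "(1 - cos \<theta>) * 1 \<le> (1 - cos \<theta>) * (1 + 2 * cos \<theta>)"
      using cos_ge by (intro mult_left_mono) auto
    finally show ?thesis by (simp add: kfac \<theta>_def power_divide)
  qed
  have k0: "\<kappa> \<ge> 0" using k_low by (meson divide_nonneg_nonneg order_trans zero_le_power2 zero_le_numeral)
  have DD: "of_real ((norm (D x))\<^sup>2) = D x * cnj (D x)" for x
    by (metis complex_norm_square)
  have cnjD: "cnj (D x) = (\<Sum>i<M. of_real (s i) * unit_exp (- (real i * x)))" for x
    by (simp add: D_def cnj_unit_exp unit_exp_of_nat_mult[symmetric])
  have Dx: "D x = (\<Sum>i<M. of_real (s i) * unit_exp (real i * x))" for x
    by (simp add: D_def unit_exp_of_nat_mult)
  have expand: "of_real (G x) = of_real \<kappa> * (D x * cnj (D x))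
      + of_real (s 0 / 2) * (unit_exp (- x) + unit_exp (real M * x)) * cnj (D x)" for x
  proof -
    define z where "z = unit_exp x"
    have w: "unit_exp (- x) * z = 1" unfolding z_def unit_exp_add[symmetric] by simp
    have "(z\<^sup>2 + 1) * D x = of_real (2 * cos \<theta>) * z * D x + of_real (s 0)
        + of_real (s 0) * z ^ Suc M"
      using sine_polynomial_identity[of z M M] sine_weight_last[of M]
      by (simp add: D_def z_def s_def \<theta>_def del: of_nat_Suc)
    then have "unit_exp (- x) * ((z\<^sup>2 + 1) * D x) = unit_exp (- x) * (of_real (2 * cos \<theta>) * z * D x
        + of_real (s 0) + of_real (s 0) * z ^ Suc M)" by simp
    then have "(unit_exp (- x) * z * z + unit_exp (- x)) * D x
       = of_real (2 * cos \<theta>) * (unit_exp (- x) * z) * D x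
        + of_real (s 0) * (unit_exp (- x) + (unit_exp (- x) * z) * z ^ M)"
      by (simp add: algebra_simps power2_eq_square)
    then have 1: "(z + unit_exp (- x)) * D x
       = of_real (2 * cos \<theta>) * D x + of_real (s 0) * (unit_exp (- x) + unit_exp (real M * x))"
      unfolding w unit_exp_of_nat_mult z_def[symmetric] by simp
    have 2: "z + unit_exp (- x) = of_real (2 * cos (2 * pi * x))"
      unfolding z_def unit_exp_eq_cis by (simp add: complex_eq_iff)
    have "of_real (G x) = (of_real (cos (2 * pi * x)) - of_real (cos (2 * \<theta>))) * (D x * cnj (D x))"
      unfolding G_def of_real_mult DD by simp
    also have "\<dots> = (1/2) * ((z + unit_exp (- x)) * D x) * cnj (D x)
        - of_real (cos (2 * \<theta>)) * (D x * cnj (D x))"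
      unfolding 2 by (simp add: algebra_simps)
    also have "\<dots> = of_real \<kappa> * (D x * cnj (D x))
      + of_real (s 0 / 2) * (unit_exp (- x) + unit_exp (real M * x)) * cnj (D x)"
      unfolding 1 \<kappa>_def by (simp add: algebra_simps)
    finally show ?thesis .
  qed
  show thesis
  proof
    show "of_real (G x) = (\<Sum>m\<in>{- int M..int M}. of_real (a m) * unit_exp (of_int m * x))" for x
    proof -
      define S where "S = {- int M..int M}"
      have pick: "(\<Sum>m\<in>S. of_real (if r = m then c else 0) * unit_exp (of_int m * x))
          = of_real c * unit_exp (of_int r * x)" if "r \<in> S" for r c
      proof -
        have "(\<Sum>m\<in>S. of_real (if r = m then c else 0) * unit_exp (of_int m * x))
            = (\<Sum>m\<in>S. if r = m then of_real c * unit_exp (of_int m * x) else 0)"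
          by (intro sum.cong) auto
        then show ?thesis using that by (simp add: S_def)
      qed
      have A: "(\<Sum>m\<in>S. of_real (\<Sum>i<M. \<Sum>j<M. if int i - int j = m then s i * s j else 0)
            * unit_exp (of_int m * x)) = D x * cnj (D x)"
      proof -
        have "(\<Sum>m\<in>S. of_real (\<Sum>i<M. \<Sum>j<M. if int i - int j = m then s i * s j else 0)
            * unit_exp (of_int m * x))
          = (\<Sum>m\<in>S. \<Sum>i<M. \<Sum>j<M. of_real (if int i - int j = m then s i * s j else 0)
            * unit_exp (of_int m * x))"
          by (simp only: of_real_sum sum_distrib_right)
        also have "\<dots> = (\<Sum>i<M. \<Sum>m\<in>S. \<Sum>j<M. of_real (if int i - int j = m then s i * s j else 0)
            * unit_exp (of_int m * x))" by (rule sum.swap)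
        also have "\<dots> = (\<Sum>i<M. \<Sum>j<M. \<Sum>m\<in>S. of_real (if int i - int j = m then s i * s j else 0)
            * unit_exp (of_int m * x))" by (intro sum.cong refl sum.swap)
        also have "\<dots> = (\<Sum>i<M. \<Sum>j<M. of_real (s i * s j) * unit_exp (of_int (int i - int j) * x))"
          by (intro sum.cong refl pick) (auto simp: S_def)
        also have "\<dots> = (\<Sum>i<M. \<Sum>j<M. (of_real (s i) * unit_exp (real i * x))
            * (of_real (s j) * unit_exp (- (real j * x))))"
        proof (intro sum.cong refl)
          fix i j
          have "of_int (int i - int j) * x = real i * x + - (real j * x)" by (simp add: algebra_simps)
          then show "of_real (s i * s j) * unit_exp (of_int (int i - int j) * x)
            = (of_real (s i) * unit_exp (real i * x)) * (of_real (s j) * unit_exp (- (real j * x)))"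
            by (simp only: unit_exp_add of_real_mult mult_ac)
        qed
        also have "\<dots> = D x * cnj (D x)" unfolding cnjD unfolding Dx by (simp only: sum_product)
        finally show ?thesis .
      qed
      have B: "(\<Sum>m\<in>S. of_real (\<Sum>i<M. (if - 1 - int i = m then s i else 0)
                       + (if int M - int i = m then s i else 0)) * unit_exp (of_int m * x))
          = (unit_exp (- x) + unit_exp (real M * x)) * cnj (D x)"
      proof -
        have "(\<Sum>m\<in>S. of_real (\<Sum>i<M. (if - 1 - int i = m then s i else 0)
                       + (if int M - int i = m then s i else 0)) * unit_exp (of_int m * x))
          = (\<Sum>m\<in>S. \<Sum>i<M. of_real (if - 1 - int i = m then s i else 0) * unit_exp (of_int m * x)
                       + of_real (if int M - int i = m then s i else 0) * unit_exp (of_int m * x))"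
          by (simp only: of_real_sum of_real_add sum_distrib_right distrib_right)
        also have "\<dots> = (\<Sum>i<M. \<Sum>m\<in>S. of_real (if - 1 - int i = m then s i else 0) * unit_exp (of_int m * x)
                       + of_real (if int M - int i = m then s i else 0) * unit_exp (of_int m * x))"
          by (rule sum.swap)
        also have "\<dots> = (\<Sum>i<M. of_real (s i) * unit_exp (of_int (- 1 - int i) * x)
                       + of_real (s i) * unit_exp (of_int (int M - int i) * x))"
          unfolding sum.distrib by (intro arg_cong2[where f="(+)"] sum.cong refl pick) (auto simp: S_def)
        also have "\<dots> = (\<Sum>i<M. (unit_exp (- x) + unit_exp (real M * x))
            * (of_real (s i) * unit_exp (- (real i * x))))"
        proof (intro sum.cong refl)
          fix i
          have e: "of_int (- 1 - int i) * x = - x + - (real i * x)"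
            "of_int (int M - int i) * x = real M * x + - (real i * x)" by (simp_all add: algebra_simps)
          show "of_real (s i) * unit_exp (of_int (- 1 - int i) * x)
                       + of_real (s i) * unit_exp (of_int (int M - int i) * x)
            = (unit_exp (- x) + unit_exp (real M * x)) * (of_real (s i) * unit_exp (- (real i * x)))"
            unfolding e unit_exp_add by (simp only: distrib_right distrib_left mult_ac)
        qed
        also have "\<dots> = (unit_exp (- x) + unit_exp (real M * x)) * cnj (D x)"
          unfolding cnjD by (simp only: sum_distrib_left)
        finally show ?thesis .
      qed
      define P where "P m = (\<Sum>i<M. \<Sum>j<M. if int i - int j = m then s i * s j else 0)" for m
      define Q where "Q m = (\<Sum>i<M. (if - 1 - int i = m then s i else 0)
                       + (if int M - int i = m then s i else 0))" for m
      have "(\<Sum>m\<in>S. of_real (a m) * unit_exp (of_int m * x))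
        = (\<Sum>m\<in>S. of_real \<kappa> * (of_real (P m) * unit_exp (of_int m * x))
            + of_real (s 0 / 2) * (of_real (Q m) * unit_exp (of_int m * x)))"
        unfolding a_def P_def[symmetric] Q_def[symmetric]
        by (simp only: of_real_add of_real_mult distrib_right mult.assoc)
      also have "\<dots> = of_real \<kappa> * (D x * cnj (D x))
          + of_real (s 0 / 2) * ((unit_exp (- x) + unit_exp (real M * x)) * cnj (D x))"
        unfolding A[symmetric] B[symmetric] P_def[symmetric] Q_def[symmetric]
        by (simp only: sum.distrib sum_distrib_left)
      finally show ?thesis unfolding expand S_def by (simp only: mult.assoc)
    qed
    have nD: "norm (D x) \<le> real M" for x
    proof -
      have "norm (D x) \<le> (\<Sum>j<M. norm (of_real (s j) * unit_exp x ^ j))"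
        unfolding D_def by (rule norm_sum)
      also have "\<dots> \<le> (\<Sum>j<M. 1)" by (intro sum_mono) (simp add: norm_mult norm_power s1)
      finally show ?thesis by simp
    qed
    show "G x \<le> 20" for x
    proof -
      have "G x \<le> (2 * \<theta>\<^sup>2) * (real M)\<^sup>2"
        unfolding G_def
      proof (rule order_trans[OF mult_right_mono mult_left_mono])
        show "cos (2 * pi * x) - cos (2 * \<theta>) \<le> 2 * \<theta>\<^sup>2"
          using one_minus cos_le_one[of "2 * pi * x"] by linarith
        show "(norm (D x))\<^sup>2 \<le> (real M)\<^sup>2" by (rule power_mono[OF nD]) simp
      qed auto
      also have "\<dots> = 2 * (\<theta> * real M)\<^sup>2" by (simp add: power_mult_distrib)
      also have "(\<theta> * real M)\<^sup>2 \<le> pi\<^sup>2" using \<theta> by (intro power_mono) (auto simp: \<theta>_def field_simps)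
      also have "pi\<^sup>2 \<le> 3.15\<^sup>2" using pi_approx by (intro power_mono) auto
      finally show ?thesis by (simp add: power2_eq_square)
    qed
    show "G x \<le> 0" if "dist_int x > 1 / real (Suc M)" for x
    proof -
      define r where "r = x - of_int (round x)"
      have r: "\<bar>r\<bar> \<le> 1 / 2" "\<bar>r\<bar> > 1 / real (Suc M)"
        using that of_int_round_abs_le[of x] by (auto simp: r_def dist_int_def abs_minus_commute)
      have "2 * pi * x = 2 * pi * r + 2 * pi * of_int (round x)" by (simp add: r_def algebra_simps)
      then have "cos (2 * pi * x) = cos (2 * pi * r)"
        by (simp add: cos_add)
      also have "\<dots> = cos (2 * pi * \<bar>r\<bar>)" by (auto simp: abs_if)
      also have "\<dots> \<le> cos (2 * \<theta>)"
      proof (rule cos_monotone_0_pi_le)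
        show "2 * \<theta> \<le> 2 * pi * \<bar>r\<bar>" using r(2) mult_left_mono[of "1 / real (Suc M)" "\<bar>r\<bar>" "2 * pi"]
          by (simp add: \<theta>_def)
        show "2 * pi * \<bar>r\<bar> \<le> pi" using r(1) mult_left_mono[of "\<bar>r\<bar>" "1/2" "2 * pi"] by simp
      qed (use \<theta> in simp)
      finally show ?thesis unfolding G_def by (intro mult_nonpos_nonneg) auto
    qed
    show "a 0 \<ge> 1 / real (Suc M)"
    proof -
      have 1: "(\<Sum>i<M. \<Sum>j<M. if int i - int j = 0 then s i * s j else 0) = (\<Sum>i<M. (s i)\<^sup>2)"
        by (intro sum.cong refl) (simp add: power2_eq_square)
      have 2: "(\<Sum>i<M. (if - 1 - int i = 0 then s i else 0)
                       + (if int M - int i = 0 then s i else 0)) = 0"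
        by (intro sum.neutral) auto
      have "a 0 = \<kappa> * (real (Suc M) / 2)"
        unfolding a_def 1 2 using sum_sine_weight_squares[OF assms] by (simp add: s_def)
      also have "\<dots> \<ge> 2 / (real (Suc M))\<^sup>2 * (real (Suc M) / 2)"
        by (intro mult_right_mono k_low) simp
      also have "2 / (real (Suc M))\<^sup>2 * (real (Suc M) / 2) = 1 / real (Suc M)"
        by (simp add: power2_eq_square del: of_nat_Suc)
      finally show ?thesis .
    qed
    show "\<bar>a m\<bar> \<le> 30 / real (Suc M)" for m
    proof -
      have 1: "\<bar>\<Sum>i<M. \<Sum>j<M. if int i - int j = m then s i * s j else 0\<bar> \<le> real M"
      proof -
        have "\<bar>\<Sum>j<M. if int i - int j = m then s i * s j else 0\<bar> \<le> 1" for i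
        proof -
          have "(\<Sum>j<M. if int i - int j = m then s i * s j else 0)
             = (\<Sum>j<M. if nat (int i - m) = j then (if int i - m \<ge> 0 then s i * s j else 0) else 0)"
            by (intro sum.cong) auto
          moreover have "\<bar>s i * s j\<bar> \<le> 1" for j
            using s1[of i] s1[of j] by (simp add: abs_mult mult_le_one)
          ultimately show ?thesis by (simp)
        qed
        then have "\<bar>\<Sum>i<M. \<Sum>j<M. if int i - int j = m then s i * s j else 0\<bar> \<le> (\<Sum>i<M. 1)"
          by (intro order_trans[OF sum_abs sum_mono]) auto
        then show ?thesis by simp
      qed
      have 2: "\<bar>\<Sum>i<M. (if - 1 - int i = m then s i else 0)
                       + (if int M - int i = m then s i else 0)\<bar> \<le> 2"
      proof -
        have "(\<Sum>i<M. (if - 1 - int i = m then s i else 0))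
            = (\<Sum>i<M. if nat (- 1 - m) = i then (if - 1 - m \<ge> 0 then s i else 0) else 0)"
          by (intro sum.cong) auto
        then have "\<bar>\<Sum>i<M. (if - 1 - int i = m then s i else 0)\<bar> \<le> 1" using s1 by simp
        moreover have "(\<Sum>i<M. (if int M - int i = m then s i else 0))
            = (\<Sum>i<M. if nat (int M - m) = i then (if int M - m \<ge> 0 then s i else 0) else 0)"
          by (intro sum.cong) auto
        then have "\<bar>\<Sum>i<M. (if int M - int i = m then s i else 0)\<bar> \<le> 1" using s1 by simp
        ultimately show ?thesis unfolding sum.distrib by linarith
      qed
      have "\<bar>a m\<bar> \<le> \<kappa> * real M + \<theta> / 2 * 2"
        unfolding a_def
        by (intro order_trans[OF abs_triangle_ineq] add_mono; unfold abs_mult)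
           (intro mult_mono 1 2; use k0 s0 in simp)+
      also have "\<kappa> * real M \<le> (2 * \<theta>\<^sup>2) * real (Suc M)" using k_up k0 by (intro mult_mono) auto
      also have "(2 * \<theta>\<^sup>2) * real (Suc M) + \<theta> / 2 * 2 = (2 * pi\<^sup>2 + pi) / real (Suc M)"
      proof -
        have *: "(2 * (pi / t)\<^sup>2) * t + pi / t / 2 * 2 = (2 * pi\<^sup>2 + pi) / t" if "t > 0" for t
          using that by (simp add: field_simps power2_eq_square)
        show ?thesis unfolding \<theta>_def by (rule *) simp
      qed
      also have "\<dots> \<le> 30 / real (Suc M)"
      proof (intro divide_right_mono)
        have "pi\<^sup>2 \<le> 3.15\<^sup>2" using pi_approx by (intro power_mono) auto
        then show "2 * pi\<^sup>2 + pi \<le> 30" using pi_approx by (simp add: power2_eq_square)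
      qed simp
      finally show ?thesis by simp
    qed
  qed
qed


section \<open>Correlations under logarithmic Fourier decay\<close>

lemma norm_fourier_transform_le_1:
  assumes "prob_space \<nu>"
  shows "norm (fourier_transform \<nu> \<xi>) \<le> 1"
proof -
  interpret prob_space \<nu> by fact
  have "norm (fourier_transform \<nu> \<xi>) \<le> (\<integral>x. norm (unit_exp (- (\<xi> \<bullet> x))) \<partial>\<nu>)"
    unfolding fourier_transform_def by (rule integral_norm_bound)
  then show ?thesis by (simp add: prob_space)
qed

text \<open>Powers of 2 as thresholds turn the logarithm into the exponent.  Below the
  range where the decay hypothesis speaks, the trivial bound 1 is absorbed into the constant.\<close>
lemma fourier_decay_dyadic:
  assumes "prob_space \<nu>" and "A > 0"
    and "C > 0" "\<And>k l :: int. real_of_int (max \<bar>k\<bar> \<bar>l\<bar>) \<ge> M \<Longrightarrow>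
           cmod (fourier_transform \<nu> (real_of_int k, real_of_int l))
             \<le> C * ln (real_of_int (max \<bar>k\<bar> \<bar>l\<bar>)) powr (- A)"
  obtains D where "D > 0"
    "\<And>(k::int) (l::int) j. 2 ^ j \<le> \<bar>k\<bar> \<Longrightarrow>
       cmod (fourier_transform \<nu> (real_of_int k, real_of_int l)) \<le> D * real (Suc j) powr (- A)"
proof -
  obtain j1 where j1: "M < 2 ^ j1" using real_arch_pow[of 2 M] by auto
  define j0 where "j0 = Suc j1"
  have j0: "M \<le> 2 ^ j" if "j \<ge> j0" for j
    using order_trans[OF less_imp_le[OF j1] power_increasing[of j1 j]] that by (simp add: j0_def)
  define D where "D = max (C * (ln 2 / 2) powr (- A)) (real (Suc j0) powr A)"
  show thesis
  proof
    show "D > 0" unfolding D_def by (simp add: less_max_iff_disj)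
    fix k l :: int and j :: nat
    assume kj: "2 ^ j \<le> \<bar>k\<bar>"
    show "cmod (fourier_transform \<nu> (real_of_int k, real_of_int l)) \<le> D * real (Suc j) powr (- A)"
    proof (cases "j \<ge> j0")
      case True
      define m where "m = real_of_int (max \<bar>k\<bar> \<bar>l\<bar>)"
      have "(2::int) ^ j \<le> max \<bar>k\<bar> \<bar>l\<bar>" using kj by simp
      then have "real_of_int (2 ^ j) \<le> m" unfolding m_def of_int_le_iff .
      then have m: "2 ^ j \<le> m" by simp
      have "ln 2 / 2 * real (Suc j) \<le> real j * ln 2"
        using True by (simp add: j0_def field_simps)
      also have "\<dots> = ln (2 ^ j)" by (simp add: ln_realpow)
      also have "\<dots> \<le> ln m" using m by (intro ln_mono) auto
      finally have lnm: "ln 2 / 2 * real (Suc j) \<le> ln m" .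
      have "M \<le> m" using j0[OF True] m by linarith
      then have "cmod (fourier_transform \<nu> (real_of_int k, real_of_int l)) \<le> C * ln m powr (- A)"
        using assms(4)[of k l] unfolding m_def by blast
      also have "\<dots> \<le> C * (ln 2 / 2 * real (Suc j)) powr (- A)"
        using lnm assms by (intro mult_left_mono powr_mono2') auto
      also have "\<dots> = C * (ln 2 / 2) powr (- A) * real (Suc j) powr (- A)"
        by (subst powr_mult) auto
      also have "\<dots> \<le> D * real (Suc j) powr (- A)"
        by (intro mult_right_mono) (auto simp: D_def)
      finally show ?thesis .
    next
      case False
      have "1 = real (Suc j) powr A * real (Suc j) powr (- A)"
        by (simp add: powr_add[symmetric])
      also have "\<dots> \<le> D * real (Suc j) powr (- A)"
      proof (intro mult_right_mono)
        have "real (Suc j) powr A \<le> real (Suc j0) powr A"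
          using False assms(2) by (intro powr_mono2) auto
        then show "real (Suc j) powr A \<le> D" by (simp add: D_def)
      qed simp
      finally show ?thesis using norm_fourier_transform_le_1[OF assms(1)] order_trans by blast
    qed
  qed
qed

lemma card_int_set_le_diameter:
  fixes F :: "int set"
  assumes "\<And>x y. x \<in> F \<Longrightarrow> y \<in> F \<Longrightarrow> \<bar>x - y\<bar> < int L"
  shows "finite F" "card F \<le> L"
proof -
  show fin: "finite F"
  proof (cases "F = {}")
    case False
    then obtain x where x: "x \<in> F" by auto
    have "F \<subseteq> {x - int L..x + int L}"
    proof
      fix y assume "y \<in> F"
      then show "y \<in> {x - int L..x + int L}" using assms[OF x] by fastforce
    qed
    then show ?thesis by (rule finite_subset) simp
  qed simp
  show "card F \<le> L"
  proof (cases "F = {}")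
    case False
    have "F \<subseteq> {Min F..<Min F + int L}"
    proof
      fix y assume y: "y \<in> F"
      have "Min F \<in> F" "Min F \<le> y" using fin False y by auto
      then show "y \<in> {Min F..<Min F + int L}" using assms[OF y, of "Min F"] by auto
    qed
    then have "card F \<le> card {Min F..<Min F + int L}" by (rule card_mono[rotated]) simp
    then show ?thesis by simp
  qed simp
qed

text \<open>A resonant pair needs \<open>|m| a \<le> 2 M b\<close>, so \<open>|m| \<le> 2 M / 4\<^sup>d\<close>; for each such \<open>m\<close> the values
  \<open>m'\<close> lie in an open window of length \<open>2\<^sup>d\<close>.  The threshold is of the order \<open>2\<^sup>d b\<close>, halfway between
  \<open>b\<close> and \<open>4\<^sup>d b \<le> a\<close> on a logarithmic scale, for two purposes: the count gains a factor
  \<open>2\<^bsup>-d\<^esup>\<close>, and nonresonant frequencies are exponentially large in \<open>d\<close>.\<close>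
lemma card_resonant_pairs:
  fixes a b M d :: nat
  assumes "b \<ge> 1" "4 ^ d * b \<le> a"
  defines "R \<equiv> {(m, m'). m \<noteq> 0 \<and> \<bar>m'\<bar> \<le> int M \<and> 2 * \<bar>m * int a - m' * int b\<bar> < 2 ^ d * int b}"
  shows "finite R" "card R * 2 ^ d \<le> 4 * M"
proof -
  define t where "t = 2 * M div 4 ^ d"
  define U where "U = {- int t..int t} - {0}"
  define F where "F m = {m'. 2 * \<bar>m * int a - m' * int b\<bar> < 2 ^ d * int b}" for m
  have F: "finite (F m)" "card (F m) \<le> 2 ^ d" for m
  proof -
    have *: "\<bar>x - y\<bar> < int (2 ^ d)" if "x \<in> F m" "y \<in> F m" for x y
    proof -
      have "2 * \<bar>x * int b - y * int b\<bar> < 2 * (2 ^ d * int b)"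
      proof -
        have "\<bar>X - Y\<bar> \<le> \<bar>W - X\<bar> + \<bar>W - Y\<bar>" for X Y W :: int by linarith
        moreover have "2 * w < 2 * L" if "w \<le> u + v" "2 * u < L" "2 * v < L" for u v w L :: int
          using that by linarith
        ultimately show ?thesis using that unfolding F_def mem_Collect_eq by blast
      qed
      then have "\<bar>x - y\<bar> * int b < 2 ^ d * int b"
        by (simp add: left_diff_distrib[symmetric] abs_mult)
      then have "\<bar>x - y\<bar> < 2 ^ d" by (rule mult_right_less_imp_less) simp
      then show ?thesis by simp
    qed
    show "finite (F m)" "card (F m) \<le> 2 ^ d" using card_int_set_le_diameter[OF *] by auto
  qed
  have cardU: "finite U" "card U \<le> 2 * t"
    unfolding U_def by (auto simp: card_Diff_subset)
  have sub: "R \<subseteq> Sigma U F"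
  proof
    fix p assume "p \<in> R"
    then obtain m m' where p: "p = (m, m')" and m: "m \<noteq> 0" "\<bar>m'\<bar> \<le> int M"
      and near: "2 * \<bar>m * int a - m' * int b\<bar> < 2 ^ d * int b" by (auto simp: R_def)
    have "(2::int) ^ d * int b \<le> 4 ^ d * int b" by (intro mult_right_mono power_mono) auto
    also have ba: "4 ^ d * int b \<le> int a"
      using assms(2) by (metis of_nat_le_iff of_nat_mult of_nat_numeral of_nat_power)
    also have "int a \<le> \<bar>m\<bar> * int a" using m(1) by (intro mult_le_cancel_right1[THEN iffD2]) auto
    finally have 1: "2 ^ d * int b \<le> \<bar>m\<bar> * int a" .
    have "\<bar>m * int a\<bar> - \<bar>m' * int b\<bar> \<le> \<bar>m * int a - m' * int b\<bar>" by linarith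
    then have "2 * (\<bar>m\<bar> * int a) \<le> 2 * (\<bar>m'\<bar> * int b) + 2 ^ d * int b"
      using near by (simp add: abs_mult)
    then have "\<bar>m\<bar> * int a \<le> 2 * (\<bar>m'\<bar> * int b)" using 1 by linarith
    also have "\<dots> \<le> 2 * (int M * int b)" using m by (intro mult_left_mono mult_right_mono) auto
    finally have "\<bar>m\<bar> * (4 ^ d * int b) \<le> 2 * (int M * int b)"
      using mult_left_mono[OF ba, of "\<bar>m\<bar>"] by linarith
    then have "(\<bar>m\<bar> * 4 ^ d) * int b \<le> (2 * int M) * int b" by (simp add: mult_ac)
    then have "\<bar>m\<bar> * 4 ^ d \<le> 2 * int M" by (rule mult_right_le_imp_le) (use assms(1) in simp)
    then have "int (nat \<bar>m\<bar> * 4 ^ d) \<le> int (2 * M)" by simp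
    then have "nat \<bar>m\<bar> * 4 ^ d \<le> 2 * M" by linarith
    then have "nat \<bar>m\<bar> \<le> t" unfolding t_def
      by (simp add: less_eq_div_iff_mult_less_eq)
    then show "p \<in> Sigma U F" using m near by (auto simp: U_def F_def p)
  qed
  have finS: "finite (Sigma U F)" using cardU F by auto
  show "finite R" using sub finS by (rule finite_subset)
  have "card R \<le> card (Sigma U F)" by (rule card_mono[OF finS sub])
  also have "\<dots> = (\<Sum>m\<in>U. card (F m))" by (rule card_SigmaI) (use cardU F in auto)
  also have "\<dots> \<le> (\<Sum>m\<in>U. 2 ^ d)" by (intro sum_mono F)
  also have "\<dots> \<le> 2 * t * 2 ^ d" using cardU by simp
  finally have "card R * 2 ^ d \<le> 2 * t * 2 ^ d * 2 ^ d" by (rule mult_right_mono) simp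
  also have "\<dots> = 2 * (t * 4 ^ d)" by (simp add: power_mult_distrib[symmetric])
  also have "\<dots> \<le> 2 * (2 * M)" unfolding t_def by (intro mult_left_mono div_times_less_eq_dividend) auto
  finally show "card R * 2 ^ d \<le> 4 * M" by simp
qed

lemma sum_square_le_twice_lower_triangle:
  fixes w :: "nat \<Rightarrow> nat \<Rightarrow> real"
  assumes "\<And>k l. w k l = w l k" "\<And>k l. w k l \<ge> 0"
  shows "(\<Sum>k<K. \<Sum>l<K. w k l) \<le> 2 * (\<Sum>k<K. \<Sum>l\<le>k. w k l)"
proof (induction K)
  case (Suc K)
  have "(\<Sum>k<Suc K. \<Sum>l<Suc K. w k l) = (\<Sum>k<K. \<Sum>l<K. w k l) + 2 * (\<Sum>l<K. w K l) + w K K"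
    using assms(1) by (simp add: sum.distrib)
  moreover have "(\<Sum>l\<le>K. w K l) = (\<Sum>l<K. w K l) + w K K"
    by (simp add: lessThan_Suc_atMost[symmetric])
  ultimately show ?case using Suc.IH assms(2)[of K K] by simp
qed simp

lemma harm_eq_sum_lessThan: "harm K = (\<Sum>k<K. 1 / real (Suc k))"
  by (induction K) (simp_all add: harm_Suc inverse_eq_divide harm_def)

text \<open>The resonant part sums to a harmonic sum over \<open>k\<close>.  The decay part contributes
  \<open>k\<^bsup>1-A\<^esup>\<close> for each \<open>k\<close>, one factor \<open>k\<close> being the number of indices \<open>l\<close>; it is summable precisely
  when \<open>A > 2\<close>.\<close>
lemma sum_correlations_le_harm:
  assumes "A > 2"
  obtains Z where "Z > 0"
    "\<And>K. (\<Sum>k<K. \<Sum>l\<le>k. (1 / 2) ^ (k - l) / real (Suc k) + real (Suc k) powr (- A))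
      \<le> Z * (1 + harm K)"
proof -
  have summ: "summable (\<lambda>k. real (Suc k) powr (1 - A))"
    using assms summable_real_powr_iff[of "1 - A"] by (subst summable_Suc_iff) auto
  define T where "T = (\<Sum>k. real (Suc k) powr (1 - A))"
  have T: "(\<Sum>k<K. real (Suc k) powr (1 - A)) \<le> T" for K
    unfolding T_def by (rule sum_le_suminf[OF summ]) auto
  have T0: "T \<ge> 0" using T[of 0] by simp
  have geo: "(\<Sum>l\<le>k. (1 / 2 :: real) ^ (k - l)) \<le> 2" for k :: nat
  proof -
    have "(\<Sum>l\<le>k. (1 / 2 :: real) ^ (k - l)) = (\<Sum>l\<le>k. (1 / 2) ^ l)"
      using sum.nat_diff_reindex[of "\<lambda>l. (1 / 2 :: real) ^ l" "Suc k"]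
      by (simp only: lessThan_Suc_atMost diff_Suc_Suc)
    also have "\<dots> \<le> (\<Sum>l. (1 / 2) ^ l)" by (intro sum_le_suminf summable_geometric) auto
    also have "\<dots> = 2" by (simp add: suminf_geometric)
    finally show ?thesis .
  qed
  show thesis
  proof (rule that[of "2 + T"])
    show "2 + T > 0" using T0 by simp
    fix K :: nat
    have "(\<Sum>l\<le>k. (1 / 2) ^ (k - l) / real (Suc k) + real (Suc k) powr (- A))
        \<le> 2 * (1 / real (Suc k)) + real (Suc k) powr (1 - A)" for k
    proof -
      have "(\<Sum>l\<le>k. (1 / 2) ^ (k - l) / real (Suc k) + real (Suc k) powr (- A))
         = (\<Sum>l\<le>k. (1 / 2) ^ (k - l)) / real (Suc k) + real (Suc k) * real (Suc k) powr (- A)"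
        by (simp add: sum.distrib flip: sum_divide_distrib)
      also have "real (Suc k) * real (Suc k) powr (- A) = real (Suc k) powr (1 - A)"
        by (simp add: powr_mult_base)
      also have "(\<Sum>l\<le>k. (1 / 2) ^ (k - l)) / real (Suc k) \<le> 2 / real (Suc k)"
        by (intro divide_right_mono geo) simp
      finally show ?thesis by simp
    qed
    then have "(\<Sum>k<K. \<Sum>l\<le>k. (1 / 2) ^ (k - l) / real (Suc k) + real (Suc k) powr (- A))
        \<le> (\<Sum>k<K. 2 * (1 / real (Suc k)) + real (Suc k) powr (1 - A))"
      by (rule sum_mono)
    also have "\<dots> = 2 * harm K + (\<Sum>k<K. real (Suc k) powr (1 - A))"
      by (simp only: sum.distrib harm_eq_sum_lessThan sum_distrib_left)
    also have "\<dots> \<le> 2 * harm K + T" using T by simp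
    also have "\<dots> \<le> (2 + T) * (1 + harm K)"
      using T0 harm_nonneg[of K, where ?'a=real] by (simp add: algebra_simps)
    finally show "(\<Sum>k<K. \<Sum>l\<le>k. (1 / 2) ^ (k - l) / real (Suc k) + real (Suc k) powr (- A))
      \<le> (2 + T) * (1 + harm K)" .
  qed
qed

text \<open>A trigonometric polynomial of degree \<open>M k\<close> with coefficients \<open>a k\<close>, without its constant term and
  evaluated at \<open>n k * \<beta> - \<delta>\<close> for \<open>x = (\<beta>, \<delta>)\<close>.  For the minorants this is the deviation from the
  mean with respect to Lebesgue measure, not with respect to \<open>\<nu>\<close>.\<close>
definition oscillation :: "(nat \<Rightarrow> nat) \<Rightarrow> (nat \<Rightarrow> nat) \<Rightarrow> (nat \<Rightarrow> int \<Rightarrow> real) \<Rightarrow> nat \<Rightarrow> real \<times> real \<Rightarrow> complex"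
  where "oscillation n M a k x =
    (\<Sum>m\<in>{- int (M k)..int (M k)} - {0}. of_real (a k m) * unit_exp (of_int m * (real (n k) * fst x - snd x)))"

lemma measurable_oscillation [measurable]: "oscillation n M a k \<in> borel_measurable borel"
  unfolding oscillation_def
  by (intro borel_measurable_sum borel_measurable_times borel_measurable_const
     measurable_compose[OF _ measurable_unit_exp]) (simp_all add: borel_prod[symmetric])

lemma measurable_cnj [measurable]: "cnj \<in> borel_measurable borel"
  by (intro borel_measurable_continuous_onI continuous_intros)

lemma correlation_oscillation:
  assumes "prob_space \<nu>" and [measurable_cong]: "sets \<nu> = sets borel"
  shows "(\<integral>x. oscillation n M a k x * cnj (oscillation n M a l x) \<partial>\<nu>)
    = (\<Sum>m\<in>{- int (M k)..int (M k)} - {0}. \<Sum>m'\<in>{- int (M l)..int (M l)} - {0}.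
        of_real (a k m * a l m') *
        fourier_transform \<nu> (of_int (m' * int (n l) - m * int (n k)), of_int (m - m')))"
proof -
  interpret prob_space \<nu> by fact
  have bil: "unit_exp (of_int m * (real (n k) * fst x - snd x)) * cnj (unit_exp (of_int m' * (real (n l) * fst x - snd x)))
    = unit_exp (- ((of_int (m' * int (n l) - m * int (n k)), of_int (m - m')) \<bullet> x))" for m m' and x :: "real \<times> real"
    unfolding cnj_unit_exp unit_exp_add[symmetric]
    by (intro arg_cong[where f=unit_exp]) (cases x, simp add: algebra_simps)
  have int: "integrable \<nu> (\<lambda>x. unit_exp (- (\<xi> \<bullet> x)))" for \<xi>
    by (rule integrable_const_bound[where B=1]) auto
  have "oscillation n M a k x * cnj (oscillation n M a l x)
    = (\<Sum>m\<in>{- int (M k)..int (M k)} - {0}. \<Sum>m'\<in>{- int (M l)..int (M l)} - {0}.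
        of_real (a k m * a l m') *
        unit_exp (- ((of_int (m' * int (n l) - m * int (n k)), of_int (m - m')) \<bullet> x)))" for x
    unfolding oscillation_def cnj_sum sum_product bil[symmetric]
    by (intro sum.cong refl) (simp add: mult_ac)
  then show ?thesis
    unfolding fourier_transform_def by (simp add: int)
qed

text \<open>Resonant pairs are few and are estimated by the trivial bound 1.  For any other pair
  the frequency is at least \<open>2\<^bsup>k-l\<^esup> n\<^sub>l / 2 \<ge> 2\<^sup>k\<close>, exponential in the larger index, so that
  the logarithmic decay yields \<open>k\<^bsup>-A\<^esup>\<close>.  There are \<open>4 M\<^sub>k M\<^sub>l\<close> pairs in all, each with a product of
  coefficients of at most \<open>30\<^sup>2 / (M\<^sub>k M\<^sub>l)\<close>, whence the constant 3600.\<close>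
lemma norm_correlation_oscillation_le:
  assumes "prob_space \<nu>" "sets \<nu> = sets borel"
    and "D \<ge> 0"
    and decay: "\<And>(u::int) (v::int) j. 2 ^ j \<le> \<bar>u\<bar> \<Longrightarrow>
       cmod (fourier_transform \<nu> (of_int u, of_int v)) \<le> D * real (Suc j) powr (- A)"
    and "l \<le> k" and nl: "4 ^ Suc l \<le> n l" and nk: "4 ^ (k - l) * n l \<le> n k"
    and M: "Suc k \<le> M k" "1 \<le> M l"
    and a: "\<And>m. \<bar>a k m\<bar> \<le> 30 / real (Suc (M k))" "\<And>m. \<bar>a l m\<bar> \<le> 30 / real (Suc (M l))"
  shows "norm (\<integral>x. oscillation n M a k x * cnj (oscillation n M a l x) \<partial>\<nu>)
    \<le> 3600 * (1 + D) * ((1 / 2) ^ (k - l) / real (Suc k) + real (Suc k) powr (- A))"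
proof -
  define S where "S j = {- int (M j)..int (M j)} - {0}" for j
  define R where "R = {(m, m'). m \<noteq> 0 \<and> \<bar>m'\<bar> \<le> int (M l)
    \<and> 2 * \<bar>m * int (n k) - m' * int (n l)\<bar> < 2 ^ (k - l) * int (n l)}"
  define \<phi> where "\<phi> p = cmod (fourier_transform \<nu>
      (of_int (snd p * int (n l) - fst p * int (n k)), of_int (fst p - snd p)))" for p
  define E where "E = D * real (Suc k) powr (- A)"
  have E: "E \<ge> 0" using assms(3) by (simp add: E_def)
  have n1: "1 \<le> n l" using nl by (metis le_trans one_le_numeral one_le_power)
  note R = card_resonant_pairs[OF n1 nk, of "M l", folded R_def]
  have finS: "finite (S j)" and cardS: "card (S j) = 2 * M j" for j
    by (auto simp: S_def card_Diff_subset)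
  have \<phi>: "\<phi> p \<le> (if p \<in> R then 1 else 0) + E" if "p \<in> S k \<times> S l" for p
  proof (cases "p \<in> R")
    case True
    then show ?thesis using norm_fourier_transform_le_1[OF assms(1)] E by (simp add: \<phi>_def add_increasing2)
  next
    case False
    obtain m m' where p: "p = (m, m')" by fastforce
    have "(2::int) ^ (k - l) * int (n l) \<le> 2 * \<bar>m * int (n k) - m' * int (n l)\<bar>"
      using False that unfolding R_def p S_def by (simp add: not_less abs_le_iff)
    moreover have "(2::int) * 2 ^ k \<le> 2 ^ (k - l) * int (n l)"
    proof -
      have "(2::nat) * 2 ^ k = 2 ^ (k - l) * 2 ^ Suc l" using \<open>l \<le> k\<close> by (simp flip: power_add)
      also have "\<dots> \<le> 2 ^ (k - l) * 4 ^ Suc l" by (intro mult_left_mono power_mono) auto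
      also have "\<dots> \<le> 2 ^ (k - l) * n l" using nl by (intro mult_left_mono) auto
      finally have "int (2 * 2 ^ k) \<le> int (2 ^ (k - l) * n l)" by (simp only: of_nat_le_iff)
      then show ?thesis by simp
    qed
    ultimately have "2 * 2 ^ k \<le> 2 * \<bar>m * int (n k) - m' * int (n l)\<bar>" by (rule order_trans[rotated])
    then have "2 ^ k \<le> \<bar>m' * int (n l) - m * int (n k)\<bar>" by (simp add: abs_minus_commute)
    then show ?thesis using decay[of k "m' * int (n l) - m * int (n k)" "m - m'"] False
      by (simp add: \<phi>_def p E_def)
  qed
  define c where "c = 900 / (real (Suc (M k)) * real (Suc (M l)))"
  have c: "c \<ge> 0" by (simp add: c_def)
  have "norm (\<integral>x. oscillation n M a k x * cnj (oscillation n M a l x) \<partial>\<nu>)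
     = norm (\<Sum>m\<in>S k. \<Sum>m'\<in>S l. of_real (a k m * a l m') *
        fourier_transform \<nu> (of_int (m' * int (n l) - m * int (n k)), of_int (m - m')))"
    unfolding correlation_oscillation[OF assms(1,2)] S_def ..
  also have "\<dots> = norm (\<Sum>p\<in>S k \<times> S l. of_real (a k (fst p) * a l (snd p)) *
        fourier_transform \<nu> (of_int (snd p * int (n l) - fst p * int (n k)), of_int (fst p - snd p)))"
    unfolding sum.cartesian_product by (simp add: case_prod_unfold)
  also have "\<dots> \<le> (\<Sum>p\<in>S k \<times> S l. \<bar>a k (fst p)\<bar> * \<bar>a l (snd p)\<bar> * \<phi> p)"
    by (rule order_trans[OF norm_sum]) (simp add: norm_mult \<phi>_def abs_mult)
  also have "\<dots> \<le> (\<Sum>p\<in>S k \<times> S l. c * ((if p \<in> R then 1 else 0) + E))"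
  proof (intro sum_mono mult_mono \<phi>)
    fix p :: "int \<times> int"
    have "\<bar>a k (fst p)\<bar> * \<bar>a l (snd p)\<bar> \<le> 30 / real (Suc (M k)) * (30 / real (Suc (M l)))"
      by (intro mult_mono a) auto
    then show "\<bar>a k (fst p)\<bar> * \<bar>a l (snd p)\<bar> \<le> c" by (simp add: c_def)
  qed (use c in \<open>auto simp: \<phi>_def\<close>)
  also have "\<dots> = c * (real (card ((S k \<times> S l) \<inter> R)) + real (card (S k \<times> S l)) * E)"
    unfolding sum_distrib_left[symmetric] sum.distrib
    using finS by (simp add: sum.If_cases)
  also have "\<dots> \<le> c * (4 * real (M l) / 2 ^ (k - l) + 4 * real (M k) * real (M l) * E)"
  proof (intro mult_left_mono add_mono c)
    have "card ((S k \<times> S l) \<inter> R) \<le> card R" by (intro card_mono R(1)) auto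
    also have "real (card R) \<le> 4 * real (M l) / 2 ^ (k - l)"
    proof -
      have "real (card R * 2 ^ (k - l)) \<le> real (4 * M l)" using R(2) by (simp only: of_nat_le_iff)
      then show ?thesis by (simp add: pos_le_divide_eq)
    qed
    finally show "real (card ((S k \<times> S l) \<inter> R)) \<le> 4 * real (M l) / 2 ^ (k - l)" by simp
    show "real (card (S k \<times> S l)) * E \<le> 4 * real (M k) * real (M l) * E"
      by (simp add: card_cartesian_product cardS)
  qed
  also have "\<dots> = 3600 * (real (M l) / real (Suc (M l)))
      * ((1 / 2) ^ (k - l) * (1 / real (Suc (M k))) + real (M k) / real (Suc (M k)) * E)"
  proof -
    have *: "900 / (u * v) * (4 * y / z + 4 * x * y * E) = 3600 * (y / v) * (1 / z * (1 / u) + x / u * E)"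
      if "u > 0" "v > 0" "z > 0" for u v x y z :: real
      using that by (simp add: field_simps)
    show ?thesis unfolding c_def power_one_over by (rule *) auto
  qed
  also have "\<dots> \<le> (3600 * 1) * ((1 / 2) ^ (k - l) * (1 / real (Suc k)) + 1 * E)"
  proof (rule mult_mono)
    show "(1 / 2) ^ (k - l) * (1 / real (Suc (M k))) + real (M k) / real (Suc (M k)) * E
        \<le> (1 / 2) ^ (k - l) * (1 / real (Suc k)) + 1 * E"
    proof (rule add_mono)
      have "1 / real (Suc (M k)) \<le> 1 / real (Suc k)" using M(1) by (intro divide_left_mono) auto
      then show "(1 / 2) ^ (k - l) * (1 / real (Suc (M k))) \<le> (1 / 2) ^ (k - l) * (1 / real (Suc k))"
        by (intro mult_left_mono) auto
      show "real (M k) / real (Suc (M k)) * E \<le> 1 * E" using E by (intro mult_right_mono) auto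
    qed
  qed (use E in \<open>auto simp: pos_divide_le_eq\<close>)
  also have "\<dots> \<le> 3600 * (1 + D) * ((1 / 2) ^ (k - l) / real (Suc k) + real (Suc k) powr (- A))"
  proof -
    have *: "3600 * (g + D * w) \<le> 3600 * (1 + D) * (g + w)" if "g \<ge> 0" "w \<ge> 0" for g w
    proof -
      have "D * g \<ge> 0" using that assms(3) by simp
      then show ?thesis using that by (simp add: algebra_simps)
    qed
    show ?thesis
      using *[of "(1 / 2) ^ (k - l) / real (Suc k)" "real (Suc k) powr (- A)"] by (simp add: E_def)
  qed
  finally show ?thesis .
qed

text \<open>With the constant terms removed from the start, the mean square is a plain
  double sum of correlations.  It is at most of the order of the harmonic sum, that is, of the expected
  number of hits itself, and not of its square.\<close>
lemma second_moment_oscillation: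
  assumes "prob_space \<nu>" and [measurable_cong]: "sets \<nu> = sets borel"
    and "A > 2" "D \<ge> 0"
    and decay: "\<And>(u::int) (v::int) j. 2 ^ j \<le> \<bar>u\<bar> \<Longrightarrow>
       cmod (fourier_transform \<nu> (of_int u, of_int v)) \<le> D * real (Suc j) powr (- A)"
    and n: "\<And>k. 4 ^ Suc k \<le> n k" "\<And>k. 4 * n k \<le> n (Suc k)"
    and M: "\<And>k. Suc k \<le> M k"
    and a: "\<And>k m. \<bar>a k m\<bar> \<le> 30 / real (Suc (M k))"
  shows "\<exists>P>0. \<forall>K. integrable \<nu> (\<lambda>x. (norm (\<Sum>k<K. oscillation n M a k x))\<^sup>2)
    \<and> (\<integral>x. (norm (\<Sum>k<K. oscillation n M a k x))\<^sup>2 \<partial>\<nu>) \<le> P * (1 + harm K)"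
proof -
  interpret prob_space \<nu> by fact
  let ?Y = "oscillation n M a"
  obtain Z where Z: "Z > 0"
    "\<And>K. (\<Sum>k<K. \<Sum>l\<le>k. (1 / 2) ^ (k - l) / real (Suc k) + real (Suc k) powr (- A))
      \<le> Z * (1 + harm K)"
    using sum_correlations_le_harm[OF \<open>A > 2\<close>] by blast
  have nkl: "4 ^ d * n l \<le> n (l + d)" for d l
  proof (induction d)
    case (Suc d)
    then show ?case using n(2)[of "l + d"] by simp
  qed simp
  have M1: "1 \<le> M l" for l using M[of l] by simp
  define w where "w k l = norm (\<integral>x. ?Y k x * cnj (?Y l x) \<partial>\<nu>)" for k l
  have w: "w k l \<le> 3600 * (1 + D) * ((1 / 2) ^ (k - l) / real (Suc k) + real (Suc k) powr (- A))"
    if "l \<le> k" for k l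
    unfolding w_def
  proof (rule norm_correlation_oscillation_le[OF assms(1,2) \<open>D \<ge> 0\<close> decay that])
    show "4 ^ (k - l) * n l \<le> n k" using nkl[of "k - l" l] that by simp
  qed (use n(1) M M1 a in blast)+
  have w_sym: "w k l = w l k" for k l
  proof -
    have "(\<integral>x. ?Y k x * cnj (?Y l x) \<partial>\<nu>) = cnj (\<integral>x. ?Y l x * cnj (?Y k x) \<partial>\<nu>)"
      by (subst Bochner_Integration.integral_cnj[symmetric]) (simp add: mult.commute)
    then show ?thesis by (simp add: w_def)
  qed
  have bnd: "norm (?Y k x) \<le> (\<Sum>m\<in>{- int (M k)..int (M k)} - {0}. \<bar>a k m\<bar>)" for k x
    unfolding oscillation_def by (rule order_trans[OF norm_sum]) (simp add: norm_mult)
  have intYY: "integrable \<nu> (\<lambda>x. ?Y k x * cnj (?Y l x))" for k l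
    by (rule integrable_const_bound[where B="(\<Sum>m\<in>{- int (M k)..int (M k)} - {0}. \<bar>a k m\<bar>)
          * (\<Sum>m\<in>{- int (M l)..int (M l)} - {0}. \<bar>a l m\<bar>)"])
       (auto simp: norm_mult intro!: mult_mono bnd sum_nonneg)
  have sq: "complex_of_real ((norm (\<Sum>k<K. ?Y k x))\<^sup>2) = (\<Sum>k<K. \<Sum>l<K. ?Y k x * cnj (?Y l x))" for K x
    unfolding complex_norm_square cnj_sum sum_product ..
  show ?thesis
  proof (intro exI conjI allI)
    show "2 * (3600 * (1 + D)) * Z > 0" using Z \<open>D \<ge> 0\<close> by simp
    fix K
    have "integrable \<nu> (\<lambda>x. complex_of_real ((norm (\<Sum>k<K. ?Y k x))\<^sup>2))"
      unfolding sq by (intro Bochner_Integration.integrable_sum intYY)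
    then show "integrable \<nu> (\<lambda>x. (norm (\<Sum>k<K. ?Y k x))\<^sup>2)"
      by (simp only: complex_of_real_integrable_eq)
    have "complex_of_real (\<integral>x. (norm (\<Sum>k<K. ?Y k x))\<^sup>2 \<partial>\<nu>)
       = (\<integral>x. (\<Sum>k<K. \<Sum>l<K. ?Y k x * cnj (?Y l x)) \<partial>\<nu>)"
      unfolding sq[symmetric] by (rule integral_complex_of_real[symmetric])
    also have "\<dots> = (\<Sum>k<K. \<Sum>l<K. \<integral>x. ?Y k x * cnj (?Y l x) \<partial>\<nu>)"
      by (simp add: intYY)
    finally have eq: "complex_of_real (\<integral>x. (norm (\<Sum>k<K. ?Y k x))\<^sup>2 \<partial>\<nu>)
       = (\<Sum>k<K. \<Sum>l<K. \<integral>x. ?Y k x * cnj (?Y l x) \<partial>\<nu>)" .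
    have "(\<integral>x. (norm (\<Sum>k<K. ?Y k x))\<^sup>2 \<partial>\<nu>) \<le> norm (complex_of_real (\<integral>x. (norm (\<Sum>k<K. ?Y k x))\<^sup>2 \<partial>\<nu>))"
      unfolding norm_of_real by (rule abs_ge_self)
    also have "\<dots> = norm (\<Sum>k<K. \<Sum>l<K. \<integral>x. ?Y k x * cnj (?Y l x) \<partial>\<nu>)" unfolding eq ..
    also have "\<dots> \<le> (\<Sum>k<K. \<Sum>l<K. w k l)"
      unfolding w_def by (intro order_trans[OF norm_sum sum_mono] norm_sum)
    also have "\<dots> \<le> 2 * (\<Sum>k<K. \<Sum>l\<le>k. w k l)"
      by (rule sum_square_le_twice_lower_triangle[OF w_sym]) (simp add: w_def)
    also have "\<dots> \<le> 2 * (\<Sum>k<K. \<Sum>l\<le>k. 3600 * (1 + D) * ((1 / 2) ^ (k - l) / real (Suc k) + real (Suc k) powr (- A)))"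
      by (intro mult_left_mono sum_mono w) auto
    also have "\<dots> = 2 * (3600 * (1 + D)) * (\<Sum>k<K. \<Sum>l\<le>k. (1 / 2) ^ (k - l) / real (Suc k) + real (Suc k) powr (- A))"
      by (simp only: sum_distrib_left mult.assoc)
    also have "\<dots> \<le> 2 * (3600 * (1 + D)) * (Z * (1 + harm K))"
      using \<open>D \<ge> 0\<close> by (intro mult_left_mono Z) auto
    finally show "(\<integral>x. (norm (\<Sum>k<K. ?Y k x))\<^sup>2 \<partial>\<nu>) \<le> 2 * (3600 * (1 + D)) * Z * (1 + harm K)"
      by (simp only: mult.assoc)
  qed
qed


section \<open>Almost sure lower bounds and the counting function\<close>

lemma measurable_dist_int [measurable]: "dist_int \<in> borel_measurable borel"
  unfolding dist_int_def round_def by measurable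

text \<open>Between two consecutive scales \<open>2 ^ 2 ^ j\<close> the number \<open>K\<close> is at most squared, so \<open>ln K\<close> at most
  doubles; monotonicity of \<open>f\<close> fills the gaps at the price of a factor 2.\<close>
lemma eventually_ln_le_of_doubly_exponential:
  fixes f :: "nat \<Rightarrow> real"
  assumes "mono f" "c \<ge> 0"
    and ev: "\<forall>\<^sub>F j in sequentially. c * ln (real (2 ^ 2 ^ j)) \<le> f (2 ^ 2 ^ j)"
  shows "\<forall>\<^sub>F K in sequentially. c / 2 * ln (real K) \<le> f K"
proof -
  obtain j0 where j0: "\<And>j. j \<ge> j0 \<Longrightarrow> c * ln (real (2 ^ 2 ^ j)) \<le> f (2 ^ 2 ^ j)"
    using ev unfolding eventually_sequentially by blast
  show ?thesis
    unfolding eventually_sequentially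
  proof (intro exI allI impI)
    fix K :: nat assume K: "2 ^ 2 ^ j0 \<le> K"
    have "(1::nat) \<le> 2 ^ 2 ^ j0" by simp
    then have K1: "1 \<le> K" using K by linarith
    have "K < 2 ^ K" by (rule less_exp)
    also have "(2::nat) ^ K \<le> 2 ^ 2 ^ K" by (intro power_increasing) (auto intro: less_imp_le less_exp)
    finally have ex: "K < 2 ^ 2 ^ K" .
    define j where "j = (LEAST j. K < 2 ^ 2 ^ j)"
    have j: "K < 2 ^ 2 ^ j" unfolding j_def using ex by (rule LeastI)
    have "j > j0"
    proof (rule ccontr)
      assume "\<not> j0 < j"
      then have "(2::nat) ^ 2 ^ j \<le> 2 ^ 2 ^ j0" by (intro power_increasing) auto
      then show False using j K by linarith
    qed
    then obtain i where i: "j = Suc i" "i \<ge> j0" by (metis less_Suc_eq_le less_imp_Suc_add le_add1)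
    have iK: "2 ^ 2 ^ i \<le> K"
      using not_less_Least[of i "\<lambda>j. K < 2 ^ 2 ^ j"] i(1) unfolding j_def by auto
    have "real K \<le> (real (2 ^ 2 ^ i))\<^sup>2"
    proof -
      have "K \<le> (2 ^ 2 ^ i)\<^sup>2" using j unfolding i(1) by (simp add: power_mult[symmetric] mult.commute)
      then have "real K \<le> real ((2 ^ 2 ^ i)\<^sup>2)" by (simp only: of_nat_le_iff)
      then show ?thesis by simp
    qed
    then have "ln (real K) \<le> ln ((real (2 ^ 2 ^ i))\<^sup>2)" using K1 by (intro ln_mono) auto
    also have "\<dots> = 2 * ln (real (2 ^ 2 ^ i))" by (simp add: ln_realpow)
    finally have "c / 2 * ln (real K) \<le> c / 2 * (2 * ln (real (2 ^ 2 ^ i)))"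
      using assms(2) by (intro mult_left_mono) auto
    also have "\<dots> = c * ln (real (2 ^ 2 ^ i))" by simp
    also have "\<dots> \<le> f (2 ^ 2 ^ i)" using j0 i(2) by blast
    also have "\<dots> \<le> f K" using assms(1) iK by (rule monoD)
    finally show "c / 2 * ln (real K) \<le> f K" .
  qed
qed

lemma measurable_counting:
  "(\<lambda>x. real (counting \<alpha> (fst x) \<gamma> (snd x) N)) \<in> borel_measurable borel"
proof -
  have "real (counting \<alpha> (fst x) \<gamma> (snd x) N) = (\<Sum>n\<in>{2..N}.
      if dist_int (real n * \<alpha> - \<gamma>) * dist_int (real n * fst x - snd x) \<le> 1 / (real n * ln (real n))
      then 1 else 0)" for x :: "real \<times> real"
    unfolding counting_def
    by (simp add: sum.If_cases Int_def conj_ac)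
  moreover have "(\<lambda>x :: real \<times> real. \<Sum>n\<in>{2..N}.
      if dist_int (real n * \<alpha> - \<gamma>) * dist_int (real n * fst x - snd x) \<le> 1 / (real n * ln (real n))
      then 1 else (0::real)) \<in> borel_measurable (borel \<Otimes>\<^sub>M borel)"
    by measurable
  ultimately show ?thesis by (simp only: borel_prod)
qed

text \<open>The choice of the constant is reduced to the countably many values \<open>1 / (i + 1)\<close>, which is legitimate because
  \<open>ln (ln N)\<close> is eventually nonnegative.\<close>
lemma good_set_in_sets_borel: "good_set \<alpha> \<gamma> \<in> sets borel"
proof -
  define h where "h x N = real (counting \<alpha> (fst x) \<gamma> (snd x) N)" for x N
  have [measurable]: "(\<lambda>x. h x N) \<in> borel_measurable borel" for N
    unfolding h_def by (rule measurable_counting)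
  have "good_set \<alpha> \<gamma> = {x. \<exists>i::nat. \<exists>N0::nat. \<forall>N\<ge>N0. h x N \<ge> 1 / real (Suc i) * ln (ln (real N))}"
    (is "_ = ?S")
  proof (intro set_eqI iffI)
    fix x assume "x \<in> good_set \<alpha> \<gamma>"
    then obtain c where c: "c > 0" and ev: "\<forall>\<^sub>F N in sequentially. h x N \<ge> c * ln (ln (real N))"
      by (auto simp: good_set_def h_def)
    obtain i where i: "1 / real (Suc i) < c" using reals_Archimedean[OF c] by (auto simp: inverse_eq_divide)
    have "\<forall>\<^sub>F N in sequentially. 0 \<le> ln (ln (real N))"
      using filterlim_compose[OF ln_at_top filterlim_compose[OF ln_at_top filterlim_real_sequentially]]
      by (simp add: filterlim_at_top)
    with ev have "\<forall>\<^sub>F N in sequentially. h x N \<ge> 1 / real (Suc i) * ln (ln (real N))"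
    proof eventually_elim
      case (elim N)
      have "1 / real (Suc i) * ln (ln (real N)) \<le> c * ln (ln (real N))"
        using i elim(2) by (intro mult_right_mono) auto
      then show ?case using elim(1) by linarith
    qed
    then show "x \<in> ?S" unfolding eventually_sequentially by blast
  next
    fix x assume "x \<in> ?S"
    then obtain i where "\<forall>\<^sub>F N in sequentially. h x N \<ge> 1 / real (Suc i) * ln (ln (real N))"
      unfolding eventually_sequentially by blast
    moreover have "1 / real (Suc i) > 0" by simp
    ultimately show "x \<in> good_set \<alpha> \<gamma>"
      unfolding good_set_def h_def by (cases x) (auto simp del: of_nat_Suc intro!: exI[of _ "1 / real (Suc i)"])
  qed
  moreover have "Measurable.pred borel (\<lambda>x. \<exists>i::nat. \<exists>N0::nat. \<forall>N\<ge>N0. h x N \<ge> 1 / real (Suc i) * ln (ln (real N)))"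
    by measurable
  ultimately show ?thesis by (simp add: pred_def)
qed

definition hits :: "(nat \<Rightarrow> nat) \<Rightarrow> (nat \<Rightarrow> nat) \<Rightarrow> real \<times> real \<Rightarrow> nat \<Rightarrow> nat set" where
  "hits n M x K = {k. k < K \<and> dist_int (real (n k) * fst x - snd x) \<le> 1 / real (Suc (M k))}"

text \<open>At \<open>n\<^sub>k\<close> the first factor of the product is at most \<open>5 / n\<^sub>k\<close>, so it suffices that the second is at most
  \<open>1 / (5 ln n\<^sub>k)\<close>.  As \<open>ln n\<^sub>k \<le> C (k + 1)\<close>, this is a condition with threshold of
  the order \<open>1 / k\<close>, and the first \<open>K\<close> members of the sequence stay below \<open>N\<close>
  as soon as \<open>C K \<le> ln N\<close>.\<close>
lemma card_hits_le_counting: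
  fixes n M :: "nat \<Rightarrow> nat"
  assumes C: "C > 0" and n4: "\<And>k. 4 * n k \<le> n (Suc k)" and npow: "\<And>k. 4 ^ Suc k \<le> n k"
    and lnn: "\<And>k. ln (real (n k)) \<le> C * real (Suc k)"
    and approx: "\<And>k. real (n k) * dist_int (real (n k) * \<alpha> - \<gamma>) \<le> 5"
    and M: "\<And>k. 5 * C * real (Suc k) \<le> real (M k)"
    and N: "C * real K \<le> ln (real N)" "N \<ge> 1"
  shows "card (hits n M x K) \<le> counting \<alpha> (fst x) \<gamma> (snd x) N"
proof -
  have n_ge: "4 \<le> n k" for k
  proof -
    have "(4::nat) ^ 1 \<le> 4 ^ Suc k" by (intro power_increasing) auto
    from order_trans[OF this npow[of k]] show ?thesis by simp
  qed
  have "strict_mono n"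
  proof (rule strict_monoI_Suc)
    fix k show "n k < n (Suc k)" using n4[of k] n_ge[of k] by linarith
  qed
  then have inj: "inj n" by (rule strict_mono_imp_inj_on)
  let ?T = "{n::nat. 2 \<le> n \<and> n \<le> N \<and>
       dist_int (real n * \<alpha> - \<gamma>) * dist_int (real n * fst x - snd x) \<le> 1 / (real n * ln (real n))}"
  have "n ` hits n M x K \<subseteq> ?T"
  proof
    fix m assume "m \<in> n ` hits n M x K"
    then obtain k where m: "m = n k" and k: "k < K"
      and hit: "dist_int (real (n k) * fst x - snd x) \<le> 1 / real (Suc (M k))" by (auto simp: hits_def)
    have pos: "real (n k) > 0" "ln (real (n k)) > 0" using n_ge[of k] by auto
    have "ln (real (n k)) \<le> C * real (Suc k)" by (rule lnn)
    also have "\<dots> \<le> C * real K" using k C by (intro mult_left_mono) auto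
    also have "\<dots> \<le> ln (real N)" by (rule N)
    finally have "n k \<le> N" using pos N(2) by simp
    moreover have "dist_int (real (n k) * \<alpha> - \<gamma>) * dist_int (real (n k) * fst x - snd x)
        \<le> 5 / real (n k) * (1 / real (Suc (M k)))"
      using approx[of k] pos hit by (intro mult_mono) (auto simp: dist_int_def field_simps)
    moreover have "5 / real (n k) * (1 / real (Suc (M k))) \<le> 1 / (real (n k) * ln (real (n k)))"
    proof -
      have "5 * ln (real (n k)) \<le> 5 * (C * real (Suc k))" using lnn[of k] by simp
      also have "\<dots> \<le> real (Suc (M k))" using M[of k] by simp
      finally have "5 / real (Suc (M k)) \<le> 1 / ln (real (n k))"
        using pos by (simp add: field_simps)
      then have "1 / real (n k) * (5 / real (Suc (M k))) \<le> 1 / real (n k) * (1 / ln (real (n k)))"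
        by (intro mult_left_mono) auto
      then show ?thesis by simp
    qed
    ultimately show "m \<in> ?T" using n_ge[of k] unfolding m by simp
  qed
  moreover have "finite ?T" by (rule finite_subset[of _ "{..N}"]) auto
  ultimately have "card (n ` hits n M x K) \<le> card ?T" by (intro card_mono)
  moreover have "card (n ` hits n M x K) = card (hits n M x K)"
    by (intro card_image inj_on_subset[OF inj]) auto
  ultimately show ?thesis by (simp add: counting_def)
qed

text \<open>The minorants sum to at most 20 times the number of hits, their constant terms sum to
  at least the harmonic sum divided by \<open>2 B\<close>, and the second moment of the deviation is at most of the
  order of the harmonic sum.  Hence the probability that the sum falls below half its constant term is \<open>O(1 / ln K)\<close>.
  Along \<open>K = 2 ^ 2 ^ j\<close> this is a geometric series, so the Borel-Cantelli lemma applies.\<close>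
lemma AE_hits_lower_bound:
  assumes "prob_space \<nu>" and sets [measurable_cong]: "sets \<nu> = sets borel"
    and "A > 2" "D \<ge> 0"
    and decay: "\<And>(u::int) (v::int) j. 2 ^ j \<le> \<bar>u\<bar> \<Longrightarrow>
       cmod (fourier_transform \<nu> (of_int u, of_int v)) \<le> D * real (Suc j) powr (- A)"
    and n: "\<And>k. 4 ^ Suc k \<le> n k" "\<And>k. 4 * n k \<le> n (Suc k)"
    and "B \<ge> (1::nat)"
  shows "\<exists>c>0. AE x in \<nu>. \<forall>\<^sub>F K in sequentially.
    c * ln (real K) \<le> real (card (hits n (\<lambda>k. B * Suc k) x K))"
proof -
  interpret prob_space \<nu> by fact
  define M where "M k = B * Suc k" for k
  have M: "Suc k \<le> M k" for k
    unfolding M_def using mult_right_mono[OF \<open>B \<ge> 1\<close>, of "Suc k"] by simp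
  \<comment> \<open>The requirements on a minorant, as a predicate on the pair of its coefficients and its
    values, so that one choice over \<open>k\<close> picks both.\<close>
  define Q where "Q k p \<longleftrightarrow>
      (\<forall>x. complex_of_real (snd p x) = (\<Sum>m\<in>{- int (M k)..int (M k)}. of_real (fst p m) * unit_exp (of_int m * x)))
    \<and> (\<forall>x. snd p x \<le> 20) \<and> (\<forall>x. dist_int x > 1 / real (Suc (M k)) \<longrightarrow> snd p x \<le> 0)
    \<and> fst p 0 \<ge> 1 / real (Suc (M k)) \<and> (\<forall>m. \<bar>fst p m\<bar> \<le> 30 / real (Suc (M k)))"
    for k and p :: "(int \<Rightarrow> real) \<times> (real \<Rightarrow> real)"
  have "\<exists>p. Q k p" for k
  proof -
    have "M k \<ge> 1" using M[of k] by simp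
    then obtain a G where "Q k (a, G)"
      unfolding Q_def fst_conv snd_conv by (rule trigonometric_minorant) blast
    then show ?thesis by blast
  qed
  then obtain p where p: "Q k (p k)" for k by metis
  define a G where "a k = fst (p k)" and "G k = snd (p k)" for k
  have G: "complex_of_real (G k x) = (\<Sum>m\<in>{- int (M k)..int (M k)}. of_real (a k m) * unit_exp (of_int m * x))"
    and G20: "G k x \<le> 20" and G0: "dist_int x > 1 / real (Suc (M k)) \<Longrightarrow> G k x \<le> 0"
    and a0: "a k 0 \<ge> 1 / real (Suc (M k))" and a: "\<bar>a k m\<bar> \<le> 30 / real (Suc (M k))" for k x m
    using p[of k] unfolding Q_def a_def[symmetric] G_def[symmetric] by blast+
  obtain P where P: "P > 0"
    "\<And>K. integrable \<nu> (\<lambda>x. (norm (\<Sum>k<K. oscillation n M a k x))\<^sup>2)"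
    "\<And>K. (\<integral>x. (norm (\<Sum>k<K. oscillation n M a k x))\<^sup>2 \<partial>\<nu>) \<le> P * (1 + harm K)"
    using second_moment_oscillation[where n=n and M=M and a=a and \<nu>=\<nu> and A=A and D=D,
          OF assms(1-4) decay n M a] by auto
  define S where "S K x = (\<Sum>k<K. G k (real (n k) * fst x - snd x))" for K and x :: "real \<times> real"
  define \<mu> where "\<mu> K = (\<Sum>k<K. a k 0)" for K
  have S_\<mu>: "(norm (\<Sum>k<K. oscillation n M a k x))\<^sup>2 = (S K x - \<mu> K)\<^sup>2" for K x
  proof -
    have "complex_of_real (G k (real (n k) * fst x - snd x)) = of_real (a k 0) + oscillation n M a k x" for k
      unfolding G oscillation_def by (subst sum.remove[of _ 0]) auto
    then have "of_real (S K x - \<mu> K) = (\<Sum>k<K. oscillation n M a k x)"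
      by (simp add: S_def \<mu>_def sum.distrib)
    then show ?thesis by (metis norm_of_real power2_abs)
  qed
  have S_le: "S K x \<le> 20 * real (card (hits n M x K))" for K x
  proof -
    have "S K x \<le> (\<Sum>k<K. if dist_int (real (n k) * fst x - snd x) \<le> 1 / real (Suc (M k)) then 20 else 0)"
      unfolding S_def by (intro sum_mono) (auto simp: G20 G0 simp del: of_nat_Suc)
    also have "\<dots> = 20 * real (card (hits n M x K))"
      by (simp add: sum.If_cases hits_def Int_def lessThan_def del: of_nat_Suc)
    finally show ?thesis .
  qed
  have \<mu>_ge: "harm K / (2 * real B) \<le> \<mu> K" for K
  proof -
    have "harm K / (2 * real B) = (\<Sum>k<K. 1 / (2 * real B * real (Suc k)))"
      unfolding harm_eq_sum_lessThan by (simp add: sum_divide_distrib field_simps)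
    also have "\<dots> \<le> \<mu> K"
      unfolding \<mu>_def
    proof (rule sum_mono)
      fix k
      have "real (Suc (M k)) \<le> real (2 * B * Suc k)" using M[of k] unfolding M_def of_nat_le_iff by simp
      then have "real (Suc (M k)) \<le> 2 * real B * real (Suc k)"
        by (simp only: of_nat_mult of_nat_numeral)
      then have "1 / (2 * real B * real (Suc k)) \<le> 1 / real (Suc (M k))"
        by (rule divide_left_mono) (use \<open>B \<ge> 1\<close> in auto)
      then show "1 / (2 * real B * real (Suc k)) \<le> a k 0" using a0[of k] by linarith
    qed
    finally show ?thesis .
  qed
  define N where "N j = (2::nat) ^ 2 ^ j" for j :: nat
  have harm_N: "2 ^ j / 2 \<le> (harm (N j) :: real)" "(1::real) \<le> harm (N j)" for j
  proof -
    have "(1::real) / 2 \<le> ln 2" using ln2_ge_two_thirds by simp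
    then have "2 ^ j * (1 / 2) \<le> 2 ^ j * ln (2::real)" by (intro mult_left_mono) auto
    also have "\<dots> = ln (real (N j))" by (simp add: N_def ln_realpow)
    also have "\<dots> \<le> ln (real (N j) + 1)" by (intro ln_mono) (auto simp: N_def)
    also have "\<dots> \<le> harm (N j)" by (rule ln_le_harm)
    finally show "2 ^ j / 2 \<le> (harm (N j) :: real)" by simp
    have "(harm 1 :: real) \<le> harm (N j)" by (intro harm_mono) (simp add: N_def)
    then show "(1::real) \<le> harm (N j)" by (simp add: harm_def)
  qed
  define E where "E j = {x \<in> space \<nu>. (\<mu> (N j) / 2)\<^sup>2 \<le> (norm (\<Sum>k<N j. oscillation n M a k x))\<^sup>2}" for j
  have E_sets: "E j \<in> sets \<nu>" for j unfolding E_def by measurable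
  have E_meas: "measure \<nu> (E j) \<le> 64 * P * (real B)\<^sup>2 * (1 / 2) ^ j" for j
  proof -
    define h where "h = (harm (N j) :: real)"
    have h: "h \<ge> 1" "h \<ge> 2 ^ j / 2" using harm_N unfolding h_def by auto
    have \<mu>h: "h / (4 * real B) \<le> \<mu> (N j) / 2" using \<mu>_ge[of "N j"] by (simp add: h_def)
    have hB: "h / (4 * real B) > 0" using h \<open>B \<ge> 1\<close> by simp
    then have \<mu>2: "(\<mu> (N j) / 2)\<^sup>2 > 0" using \<mu>h by (intro zero_less_power) linarith
    have "measure \<nu> (E j) \<le> (\<integral>x. (norm (\<Sum>k<N j. oscillation n M a k x))\<^sup>2 \<partial>\<nu>) / (\<mu> (N j) / 2)\<^sup>2"
      unfolding E_def
      by (rule integral_Markov_inequality_measure[OF P(2) _ _ \<mu>2, where A="{}"]) auto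
    also have "\<dots> \<le> (P * (1 + h)) / (h / (4 * real B))\<^sup>2"
    proof (rule frac_le)
      show "0 \<le> P * (1 + h)" using P(1) h by simp
      show "(\<integral>x. (norm (\<Sum>k<N j. oscillation n M a k x))\<^sup>2 \<partial>\<nu>) \<le> P * (1 + h)"
        unfolding h_def by (rule P(3))
      show "0 < (h / (4 * real B))\<^sup>2" using hB by (rule zero_less_power)
      show "(h / (4 * real B))\<^sup>2 \<le> (\<mu> (N j) / 2)\<^sup>2"
        using \<mu>h less_imp_le[OF hB] by (rule power_mono)
    qed
    also have "\<dots> \<le> (P * (2 * h)) / (h / (4 * real B))\<^sup>2"
      using P(1) h by (intro divide_right_mono mult_left_mono) auto
    also have "\<dots> = 32 * P * (real B)\<^sup>2 / h"
      using h \<open>B \<ge> 1\<close> by (simp add: field_simps power2_eq_square)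
    also have "\<dots> \<le> 32 * P * (real B)\<^sup>2 / (2 ^ j / 2)"
      using P(1) h by (intro divide_left_mono) auto
    also have "\<dots> = 64 * P * (real B)\<^sup>2 * (1 / 2) ^ j" by (simp add: power_one_over)
    finally show ?thesis .
  qed
  have "AE x in \<nu>. \<forall>\<^sub>F j in sequentially. x \<in> space \<nu> - E j"
  proof (rule borel_cantelli_AE1[OF E_sets])
    show "emeasure \<nu> (E j) < \<infinity>" for j by (simp add: emeasure_eq_measure)
    show "summable (\<lambda>j. measure \<nu> (E j))"
      by (rule summable_comparison_test'[where N=0 and g="\<lambda>j. 64 * P * (real B)\<^sup>2 * (1 / 2) ^ j"])
         (auto intro!: summable_mult summable_geometric simp: E_meas)
  qed
  then have AE: "AE x in \<nu>. \<forall>\<^sub>F K in sequentially.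
      1 / (80 * real B) / 2 * ln (real K) \<le> real (card (hits n M x K))"
  proof eventually_elim
    case (elim x)
    show ?case
    proof (rule eventually_ln_le_of_doubly_exponential)
      show "mono (\<lambda>K. real (card (hits n M x K)))"
        by (intro monoI of_nat_mono card_mono) (auto simp: hits_def)
      show "\<forall>\<^sub>F j in sequentially. 1 / (80 * real B) * ln (real (2 ^ 2 ^ j)) \<le> real (card (hits n M x (2 ^ 2 ^ j)))"
        using elim
      proof eventually_elim
        case (elim j)
        have "0 \<le> harm (N j) / (2 * real B)" by (simp add: harm_nonneg)
        then have \<mu>0: "\<mu> (N j) / 2 \<ge> 0" using \<mu>_ge[of "N j"] by linarith
        have "\<bar>S (N j) x - \<mu> (N j)\<bar>\<^sup>2 < (\<mu> (N j) / 2)\<^sup>2"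
          using elim by (simp add: E_def S_\<mu> not_le)
        then have "\<bar>S (N j) x - \<mu> (N j)\<bar> < \<mu> (N j) / 2"
          using \<mu>0 by (rule power2_less_imp_less)
        then have "\<mu> (N j) / 2 \<le> S (N j) x" by linarith
        also have "\<dots> \<le> 20 * real (card (hits n M x (N j)))" by (rule S_le)
        finally have "\<mu> (N j) \<le> 40 * real (card (hits n M x (N j)))" by simp
        moreover have "ln (real (N j)) / (2 * real B) \<le> \<mu> (N j)"
        proof -
          have "ln (real (N j)) \<le> ln (real (N j) + 1)" by (intro ln_mono) (auto simp: N_def)
          also have "\<dots> \<le> harm (N j)" by (rule ln_le_harm)
          finally have "ln (real (N j)) / (2 * real B) \<le> harm (N j) / (2 * real B)"
            by (intro divide_right_mono) auto
          then show ?thesis using \<mu>_ge[of "N j"] by linarith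
        qed
        ultimately have "ln (real (N j)) / (2 * real B) \<le> 40 * real (card (hits n M x (N j)))" by linarith
        then show ?case unfolding N_def by simp
      qed
    qed simp
  qed
  have M_eq: "M = (\<lambda>k. B * Suc k)" by (simp add: M_def fun_eq_iff)
  have "1 / (80 * real B) / 2 > 0" using \<open>B \<ge> 1\<close> by simp
  then show ?thesis using AE unfolding M_eq by (intro exI conjI)
qed

lemma sqrt_ln_at_top: "filterlim (\<lambda>N. sqrt (ln (real N))) at_top sequentially"
  by (intro filterlim_compose[OF sqrt_at_top] filterlim_compose[OF ln_at_top] filterlim_real_sequentially)

text \<open>The number of admissible \<open>k\<close> is about \<open>ln N / C\<close>.  Only its logarithm matters, so it may be
  replaced by \<open>sqrt (ln N)\<close>, which is free of \<open>C\<close> and has logarithm \<open>ln (ln N) / 2\<close>.\<close>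
lemma eventually_sqrt_ln_le_floor:
  assumes "C > (0::real)"
  shows "\<forall>\<^sub>F N in sequentially. sqrt (ln (real N)) \<le> real (nat \<lfloor>ln (real N) / C\<rfloor>)
    \<and> 1 < sqrt (ln (real N))"
proof -
  have "\<forall>\<^sub>F N in sequentially. 2 * C + 2 \<le> sqrt (ln (real N))"
    using sqrt_ln_at_top by (simp add: filterlim_at_top)
  then show ?thesis
  proof eventually_elim
    case (elim N)
    define s where "s = sqrt (ln (real N))"
    have s: "s \<ge> 2 * C + 2" using elim by (simp add: s_def)
    have s1: "s > 1" using s assms by simp
    have "sqrt (ln (real N)) > 0" using s1 unfolding s_def by linarith
    then have sq: "ln (real N) = s\<^sup>2" by (simp add: s_def)
    have "(2 * C) * s \<le> s * s" using s s1 by (intro mult_right_mono) auto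
    then have "2 * s \<le> s\<^sup>2 / C" using assms by (simp add: field_simps power2_eq_square)
    then have "s \<le> s\<^sup>2 / C - 1" using s1 by linarith
    also have "\<dots> \<le> real_of_int \<lfloor>s\<^sup>2 / C\<rfloor>" by linarith
    also have "\<dots> \<le> real (nat \<lfloor>s\<^sup>2 / C\<rfloor>)" by linarith
    finally show ?case using s1 unfolding sq[symmetric] s_def by simp
  qed
qed

theorem theorem1p15:
  fixes A \<alpha> \<gamma> :: real and \<nu> :: "(real \<times> real) measure"
  assumes "A > 2"
    and "prob_space \<nu>"
    and "sets \<nu> = sets borel"
    and "measure \<nu> ({0..1} \<times> {0..1}) = 1"
    and "\<exists>C>0. \<exists>M. \<forall>k l :: int. real_of_int (max \<bar>k\<bar> \<bar>l\<bar>) \<ge> M \<longrightarrow>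
           cmod (fourier_transform \<nu> (real_of_int k, real_of_int l))
             \<le> C * ln (real_of_int (max \<bar>k\<bar> \<bar>l\<bar>)) powr (- A)"
    and "\<alpha> \<in> class_K"
  shows "measure \<nu> (good_set \<alpha> \<gamma>) = 1"
proof -
  interpret prob_space \<nu> by fact
  obtain D where D: "D > 0" "\<And>(u::int) (v::int) j. 2 ^ j \<le> \<bar>u\<bar> \<Longrightarrow>
       cmod (fourier_transform \<nu> (of_int u, of_int v)) \<le> D * real (Suc j) powr (- A)"
  proof -
    obtain C M where CM: "C > 0" "\<And>k l :: int. real_of_int (max \<bar>k\<bar> \<bar>l\<bar>) \<ge> M \<Longrightarrow>
           cmod (fourier_transform \<nu> (real_of_int k, real_of_int l))
             \<le> C * ln (real_of_int (max \<bar>k\<bar> \<bar>l\<bar>)) powr (- A)"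
      using assms(5) by blast
    have "A > 0" using assms(1) by simp
    from fourier_decay_dyadic[OF assms(2) this CM] that show thesis by blast
  qed
  obtain n C where n: "C > 0" "\<And>k. 4 * n k \<le> n (Suc k)" "\<And>k. 4 ^ Suc k \<le> n k"
    "\<And>k. ln (real (n k)) \<le> C * real (Suc k)"
    "\<And>k. real (n k) * dist_int (real (n k) * \<alpha> - \<gamma>) \<le> 5"
    using class_K_lacunary_sequence[OF assms(6)] by metis
  define B where "B = nat \<lceil>5 * C\<rceil>"
  have B: "5 * C \<le> real B" "B \<ge> 1" using n(1) by (auto simp: B_def of_nat_ceiling Suc_le_eq)
  have M: "5 * C * real (Suc k) \<le> real (B * Suc k)" for k
    using B(1) by (simp only: of_nat_mult mult_right_mono of_nat_0_le_iff)
  have D0: "D \<ge> 0" using D(1) by simp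
  obtain c where c: "c > 0" and AE: "AE x in \<nu>. \<forall>\<^sub>F K in sequentially.
      c * ln (real K) \<le> real (card (hits n (\<lambda>k. B * Suc k) x K))"
    using AE_hits_lower_bound[where n=n and B=B and \<nu>=\<nu> and A=A and D=D, OF assms(2,3,1) D0 D(2) n(3,2) B(2)]
    by blast
  from AE have "AE x in \<nu>. x \<in> good_set \<alpha> \<gamma>"
  proof eventually_elim
    case (elim x)
    then obtain K0 where K0: "\<And>K. K \<ge> K0 \<Longrightarrow>
        c * ln (real K) \<le> real (card (hits n (\<lambda>k. B * Suc k) x K))"
      unfolding eventually_sequentially by blast
    have "\<forall>\<^sub>F N in sequentially. real K0 \<le> sqrt (ln (real N))"
      using sqrt_ln_at_top by (simp add: filterlim_at_top)
    with eventually_sqrt_ln_le_floor[OF n(1)] eventually_ge_at_top[of "1::nat"]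
    have "\<forall>\<^sub>F N in sequentially. c / 2 * ln (ln (real N)) \<le> real (counting \<alpha> (fst x) \<gamma> (snd x) N)"
    proof eventually_elim
      case (elim N)
      define K where "K = nat \<lfloor>ln (real N) / C\<rfloor>"
      have K: "sqrt (ln (real N)) \<le> real K" "real K0 \<le> real K" "1 < sqrt (ln (real N))"
        using elim by (auto simp: K_def)
      have L: "ln (real N) > 0" using K(3) by simp
      have "real K = real_of_int \<lfloor>ln (real N) / C\<rfloor>" using L n(1) by (simp add: K_def)
      also have "\<dots> \<le> ln (real N) / C" by linarith
      finally have CK: "C * real K \<le> ln (real N)" using n(1) by (simp add: field_simps)
      have "ln (ln (real N)) = 2 * ln (sqrt (ln (real N)))" using L by (simp add: ln_sqrt)
      then have "c / 2 * ln (ln (real N)) = c * ln (sqrt (ln (real N)))" by simp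
      also have "\<dots> \<le> c * ln (real K)" using c K by (intro mult_left_mono ln_mono) auto
      also have "\<dots> \<le> real (card (hits n (\<lambda>k. B * Suc k) x K))" using K0 K(2) by simp
      also have "\<dots> \<le> real (counting \<alpha> (fst x) \<gamma> (snd x) N)"
        using card_hits_le_counting[OF n M CK] elim(2) by simp
      finally show ?case .
    qed
    moreover have "c / 2 > 0" using c by simp
    ultimately show ?case unfolding good_set_def by (cases x) (auto intro!: exI[of _ "c / 2"])
  qed
  moreover have "good_set \<alpha> \<gamma> \<in> sets \<nu>" using good_set_in_sets_borel assms(3) by simp
  ultimately show ?thesis by (simp add: prob_eq_1)
qed

end
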